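(* Let $n$ be a prime number, let $p_1,p_2,p_3,p_4\in\mathbb{Z}^{+}$, let $P_4^4=(p_1,-p_2,p_3,-p_4)$ be an oriented pretzel link, and let $\mathbb{Z}_n$ be the dihedral quandle. Put $h=-p_1p_2p_3+p_1p_2p_4-p_1p_3p_4+p_2p_3p_4$. Then, with all congruences modulo $n$, $$|\mathrm{Hom}(\mathcal{Q}(P_4^4),\mathbb{Z}_n)|=\begin{cases} n & \text{if } h\not\equiv 0;\\ n^2 & \text{if } h\equiv 0 \text{ and } p_ip_j\not\equiv 0 \text{ for at least one pair } i\neq j,\ i,j\in\{1,2,3,4\};\\ n^3 & \text{if exactly one of } p_1,p_2,p_3,p_4 \text{ is coprime with } n;\\ n^4 & \text{if } p_1\equiv p_2\equiv p_3\equiv p_4\equiv 0.\end{cases}$$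
   Context: A quandle is a set $X$ with a binary operation $\triangleright$ such that $x\triangleright x=x$ for all $x$; for each $y$ the map $x\mapsto x\triangleright y$ is invertible; and $(x\triangleright y)\triangleright z=(x\triangleright z)\triangleright(y\triangleright z)$ for all $x,y,z$. A quandle homomorphism $f$ satisfies $f(x\triangleright y)=f(x)\triangleright f(y)$. The dihedral quandle $\mathbb{Z}_n$ is the set of integers modulo $n$ with $x\triangleright y=2y-x \pmod n$. For an oriented link $K$ with diagram $D$, the fundamental quandle $\mathcal{Q}(K)$ is the quandle generated by the arcs of $D$ with one relation per crossing: if the overcrossing arc is $y$ (pointing up), and $x$ is the undercrossing arc on the right of $y$, then the undercrossing arc on the left of $y$ is $x\triangleright y$. $\mathrm{Hom}(\mathcal{Q}(K),X)$ is the set of quandle homomorphisms (colorings of $K$ by $X$); its cardinality is the coloring number of $K$ (with respect to $X$). Pretzel link: for nonzero integers $p_1,\dots,p_m$, the pretzel link $(p_1,\dots,p_m)$ (an $m$-pretzel link) is formed from $m$ tangles $A_1,\dots,A_m$ placed side by side, where $A_i$ is a vertical column of two strands twisted about each other with $|p_i|$ crossings, all of one fixed handedness if $p_i>0$ ("positive") and all of the opposite handedness if $p_i<0$ ("negative"). The NE endpoint of $A_i$ is joined to the NW endpoint of $A_{i+1}$, the SE endpoint of $A_i$ to the SW endpoint of $A_{i+1}$, and the outer endpoints are closed up by joining the NW (resp. SW) endpoint of $A_1$ to the NE (resp. SE) endpoint of $A_m$. Any orientation of the link may be chosen. *)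

theory Defs
  imports "HOL-Number_Theory.Cong" "HOL-Computational_Algebra.Primes"
    "HOL-Library.FuncSet" "HOL-Algebra.Congruence"
begin

section \<open>Quandles\<close>

record 'a quandle_struct = "'a partial_object" +
  act :: "'a \<Rightarrow> 'a \<Rightarrow> 'a" (infixl \<open>\<triangleright>\<index>\<close> 70)

locale quandle =
  fixes X (structure)
  assumes act_closed: "\<lbrakk>x \<in> carrier X; y \<in> carrier X\<rbrakk> \<Longrightarrow> x \<triangleright> y \<in> carrier X"
    and act_idem: "x \<in> carrier X \<Longrightarrow> x \<triangleright> x = x"
    and act_bij: "y \<in> carrier X \<Longrightarrow> bij_betw (\<lambda>x. x \<triangleright> y) (carrier X) (carrier X)"
    and act_distrib: "\<lbrakk>x \<in> carrier X; y \<in> carrier X; z \<in> carrier X\<rbrakk> \<Longrightarrow>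
      (x \<triangleright> y) \<triangleright> z = (x \<triangleright> z) \<triangleright> (y \<triangleright> z)"

text \<open>Homomorphisms are extensional functions on the carrier, so that they can be counted.\<close>

definition quandle_Hom ::
    "('a, 'u) quandle_struct_scheme \<Rightarrow> ('b, 'v) quandle_struct_scheme \<Rightarrow> ('a \<Rightarrow> 'b) set" where
  "quandle_Hom Q X = {f \<in> carrier Q \<rightarrow>\<^sub>E carrier X.
     \<forall>x\<in>carrier Q. \<forall>y\<in>carrier Q. f (x \<triangleright>\<^bsub>Q\<^esub> y) = f x \<triangleright>\<^bsub>X\<^esub> f y}"

definition dihedral_quandle :: "nat \<Rightarrow> int quandle_struct" where
  "dihedral_quandle n = \<lparr>carrier = {0..<int n}, act = (\<lambda>x y. (2 * y - x) mod int n)\<rparr>"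

lemma quandle_dihedral:
  assumes "n > 0"
  shows "quandle (dihedral_quandle n)"
proof
  fix y :: int
  let ?f = "\<lambda>x. (2 * y - x) mod int n"
  have *: "?f (?f x) = x" if "x \<in> {0..<int n}" for x
    using that by (simp add: mod_diff_right_eq)
  have "bij_betw ?f {0..<int n} {0..<int n}"
    by (rule bij_betwI[where g = ?f]) (use * assms in auto)
  then show "bij_betw (\<lambda>x. x \<triangleright>\<^bsub>dihedral_quandle n\<^esub> y)
      (carrier (dihedral_quandle n)) (carrier (dihedral_quandle n))"
    by (simp add: dihedral_quandle_def)
next
  fix x y z :: int
  have "(2 * z - (2 * y - x) mod int n) mod int n = (2 * z - (2 * y - x)) mod int n"
    by (simp add: mod_diff_right_eq)
  also have "\<dots> = (2 * (2 * z - y) - (2 * z - x)) mod int n"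
    by (simp add: algebra_simps)
  also have "\<dots> = (2 * ((2 * z - y) mod int n) - (2 * z - x) mod int n) mod int n"
    by (intro mod_diff_cong) (simp_all add: mod_mult_right_eq)
  finally show "x \<triangleright>\<^bsub>dihedral_quandle n\<^esub> y \<triangleright>\<^bsub>dihedral_quandle n\<^esub> z =
      x \<triangleright>\<^bsub>dihedral_quandle n\<^esub> z \<triangleright>\<^bsub>dihedral_quandle n\<^esub> (y \<triangleright>\<^bsub>dihedral_quandle n\<^esub> z)"
    by (simp add: dihedral_quandle_def)
qed (use assms in \<open>auto simp: dihedral_quandle_def\<close>)


section \<open>Quandles given by generators and relations\<close>

text \<open>\<open>ActInv x y\<close> stands for the preimage of \<open>x\<close> under the invertible map \<open>\<lambda>z. z \<triangleright> y\<close>.\<close>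

datatype 'a qterm =
    Gen 'a
  | Act "'a qterm" "'a qterm"
  | ActInv "'a qterm" "'a qterm"

definition qterms :: "'a set \<Rightarrow> 'a qterm set" where
  "qterms A = {t. set_qterm t \<subseteq> A}"

inductive qeq :: "'a set \<Rightarrow> ('a qterm \<times> 'a qterm) set \<Rightarrow> 'a qterm \<Rightarrow> 'a qterm \<Rightarrow> bool"
  for A R where
  qeq_base: "\<lbrakk>(s, t) \<in> R; s \<in> qterms A; t \<in> qterms A\<rbrakk> \<Longrightarrow> qeq A R s t"
| qeq_refl: "s \<in> qterms A \<Longrightarrow> qeq A R s s"
| qeq_sym: "qeq A R s t \<Longrightarrow> qeq A R t s"
| qeq_trans: "\<lbrakk>qeq A R s t; qeq A R t u\<rbrakk> \<Longrightarrow> qeq A R s u"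
| qeq_cong_Act: "\<lbrakk>qeq A R s s'; qeq A R t t'\<rbrakk> \<Longrightarrow> qeq A R (Act s t) (Act s' t')"
| qeq_cong_ActInv: "\<lbrakk>qeq A R s s'; qeq A R t t'\<rbrakk> \<Longrightarrow> qeq A R (ActInv s t) (ActInv s' t')"
| qeq_idem: "s \<in> qterms A \<Longrightarrow> qeq A R (Act s s) s"
| qeq_ActInv_Act: "\<lbrakk>s \<in> qterms A; t \<in> qterms A\<rbrakk> \<Longrightarrow> qeq A R (ActInv (Act s t) t) s"
| qeq_Act_ActInv: "\<lbrakk>s \<in> qterms A; t \<in> qterms A\<rbrakk> \<Longrightarrow> qeq A R (Act (ActInv s t) t) s"
| qeq_distrib: "\<lbrakk>s \<in> qterms A; t \<in> qterms A; u \<in> qterms A\<rbrakk> \<Longrightarrow>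
    qeq A R (Act (Act s t) u) (Act (Act s u) (Act t u))"

definition qeq_rel :: "'a set \<Rightarrow> ('a qterm \<times> 'a qterm) set \<Rightarrow> ('a qterm \<times> 'a qterm) set" where
  "qeq_rel A R = {(s, t). qeq A R s t}"

definition presented_quandle ::
    "'a set \<Rightarrow> ('a qterm \<times> 'a qterm) set \<Rightarrow> 'a qterm set quandle_struct" where
  "presented_quandle A R =
    \<lparr>carrier = qterms A // qeq_rel A R,
     act = (\<lambda>P Q. \<Union>s\<in>P. \<Union>t\<in>Q. qeq_rel A R `` {Act s t})\<rparr>"

lemma qterms_simps [simp]:
  "Gen a \<in> qterms A \<longleftrightarrow> a \<in> A"
  "Act s t \<in> qterms A \<longleftrightarrow> s \<in> qterms A \<and> t \<in> qterms A"
  "ActInv s t \<in> qterms A \<longleftrightarrow> s \<in> qterms A \<and> t \<in> qterms A"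
  by (auto simp: qterms_def)

lemma qeq_qterms: "qeq A R s t \<Longrightarrow> s \<in> qterms A \<and> t \<in> qterms A"
  by (induction rule: qeq.induct) auto

lemma equiv_qeq_rel: "equiv (qterms A) (qeq_rel A R)"
proof (rule equivI)
  show "qeq_rel A R \<subseteq> qterms A \<times> qterms A"
    by (auto simp: qeq_rel_def dest: qeq_qterms)
  show "refl_on (qterms A) (qeq_rel A R)"
    by (auto simp: refl_on_def qeq_rel_def intro: qeq_refl)
  show "sym_on UNIV (qeq_rel A R)"
    by (auto simp: sym_on_def qeq_rel_def intro: qeq_sym)
  show "trans_on UNIV (qeq_rel A R)"
    by (auto simp: trans_on_def qeq_rel_def intro: qeq_trans)
qed

lemma qeq_class_eq_iff:
  "\<lbrakk>s \<in> qterms A; t \<in> qterms A\<rbrakk> \<Longrightarrow>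
    qeq_rel A R `` {s} = qeq_rel A R `` {t} \<longleftrightarrow> qeq A R s t"
  using eq_equiv_class_iff[OF equiv_qeq_rel, of s A t R] by (simp add: qeq_rel_def)

lemma presented_act_class:
  assumes "s \<in> qterms A" "t \<in> qterms A"
  shows "(qeq_rel A R `` {s}) \<triangleright>\<^bsub>presented_quandle A R\<^esub> (qeq_rel A R `` {t})
      = qeq_rel A R `` {Act s t}"
proof -
  let ?c = "\<lambda>s. qeq_rel A R `` {s}"
  have eq: "?c (Act s' t') = ?c (Act s t)" if "s' \<in> ?c s" "t' \<in> ?c t" for s' t'
  proof -
    have "qeq A R (Act s' t') (Act s t)"
      using that by (simp add: qeq_rel_def qeq_cong_Act qeq_sym)
    then show ?thesis
      using qeq_class_eq_iff qeq_qterms by blast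
  qed
  have "(\<Union>s'\<in>?c s. \<Union>t'\<in>?c t. ?c (Act s' t')) = (\<Union>s'\<in>?c s. \<Union>t'\<in>?c t. ?c (Act s t))"
    by (intro SUP_cong refl eq)
  also have "\<dots> = ?c (Act s t)"
  proof -
    have "?c s \<noteq> {}" "?c t \<noteq> {}"
      using equiv_class_self[OF equiv_qeq_rel] assms by blast+
    then show ?thesis
      by (simp only: UN_constant if_False)
  qed
  finally show ?thesis
    by (simp add: presented_quandle_def)
qed

lemma quandle_presented: "quandle (presented_quandle A R)"
proof -
  let ?X = "presented_quandle A R"
  let ?c = "\<lambda>s. qeq_rel A R `` {s}"
  have carr: "carrier ?X = ?c ` qterms A"
    by (auto simp: presented_quandle_def quotient_def)
  note act = presented_act_class[of _ A _ R]
  show ?thesis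
  proof
    fix x y assume "x \<in> carrier ?X" "y \<in> carrier ?X"
    then obtain s t where "s \<in> qterms A" "x = ?c s" "t \<in> qterms A" "y = ?c t"
      by (auto simp: carr)
    then show "x \<triangleright>\<^bsub>?X\<^esub> y \<in> carrier ?X"
      by (simp add: carr act)
  next
    fix x assume "x \<in> carrier ?X"
    then obtain s where "s \<in> qterms A" "x = ?c s"
      by (auto simp: carr)
    then show "x \<triangleright>\<^bsub>?X\<^esub> x = x"
      by (simp add: act qeq_class_eq_iff qeq_idem)
  next
    fix y assume "y \<in> carrier ?X"
    then obtain t where t: "t \<in> qterms A" "y = ?c t"
      by (auto simp: carr)
    show "bij_betw (\<lambda>x. x \<triangleright>\<^bsub>?X\<^esub> y) (carrier ?X) (carrier ?X)"
    proof (rule bij_betw_imageI)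
      show "inj_on (\<lambda>x. x \<triangleright>\<^bsub>?X\<^esub> y) (carrier ?X)"
      proof (rule inj_onI)
        fix u v assume "u \<in> carrier ?X" "v \<in> carrier ?X"
          and e: "u \<triangleright>\<^bsub>?X\<^esub> y = v \<triangleright>\<^bsub>?X\<^esub> y"
        then obtain r s where rs: "r \<in> qterms A" "u = ?c r" "s \<in> qterms A" "v = ?c s"
          by (auto simp: carr)
        then have "qeq A R (Act r t) (Act s t)"
          using e t by (simp add: act qeq_class_eq_iff)
        then have "qeq A R (ActInv (Act r t) t) (ActInv (Act s t) t)"
          using t by (blast intro: qeq_cong_ActInv qeq_refl)
        then have "qeq A R r s"
          using rs t by (meson qeq_ActInv_Act qeq_sym qeq_trans)
        then show "u = v"
          using rs by (simp add: qeq_class_eq_iff)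
      qed
      have "?c s \<in> (\<lambda>x. x \<triangleright>\<^bsub>?X\<^esub> y) ` carrier ?X" if "s \<in> qterms A" for s
      proof (rule image_eqI[where x = "?c (ActInv s t)"])
        show "?c s = ?c (ActInv s t) \<triangleright>\<^bsub>?X\<^esub> y"
          using that t by (simp add: act qeq_class_eq_iff qeq_sym[OF qeq_Act_ActInv])
        show "?c (ActInv s t) \<in> carrier ?X"
          using that t by (simp add: carr)
      qed
      moreover have "u \<triangleright>\<^bsub>?X\<^esub> y \<in> carrier ?X" if "u \<in> carrier ?X" for u
      proof -
        obtain s where "s \<in> qterms A" "u = ?c s"
          using \<open>u \<in> carrier ?X\<close> by (auto simp: carr)
        then show ?thesis
          using t by (simp add: carr act)
      qed
      ultimately show "(\<lambda>x. x \<triangleright>\<^bsub>?X\<^esub> y) ` carrier ?X = carrier ?X"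
        unfolding carr by blast
    qed
  next
    fix x y z assume "x \<in> carrier ?X" "y \<in> carrier ?X" "z \<in> carrier ?X"
    then obtain s t u where "s \<in> qterms A" "x = ?c s" "t \<in> qterms A" "y = ?c t"
        "u \<in> qterms A" "z = ?c u"
      by (auto simp: carr)
    then show "x \<triangleright>\<^bsub>?X\<^esub> y \<triangleright>\<^bsub>?X\<^esub> z = x \<triangleright>\<^bsub>?X\<^esub> z \<triangleright>\<^bsub>?X\<^esub> (y \<triangleright>\<^bsub>?X\<^esub> z)"
      by (simp add: act qeq_class_eq_iff qeq_distrib)
  qed
qed


section \<open>Oriented link diagrams and the fundamental quandle\<close>

text \<open>
  A crossing is drawn as an X in the plane; its four ends are named by their compass
  positions, and the two strands through it are NW--SE and NE--SW.
\<close>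

datatype corner = NW | NE | SW | SE

fun opposite :: "corner \<Rightarrow> corner" where
  "opposite NW = SE"
| "opposite SE = NW"
| "opposite NE = SW"
| "opposite SW = NE"

text \<open>The next corner in counterclockwise direction.\<close>

fun ccw :: "corner \<Rightarrow> corner" where
  "ccw NW = SW"
| "ccw SW = SE"
| "ccw SE = NE"
| "ccw NE = NW"

text \<open>
  \<open>overs D c\<close> consists of the two ends of the overcrossing strand at \<open>c\<close>.  The edges of the
  diagram are given by the map \<open>glue D\<close>, which sends each crossing end to the crossing end at
  the other end of the same edge.  Components without crossings are not represented.
  Planarity of the gluing is not part of well-formedness; the fundamental quandle is read off
  from the crossings and the way in which they are joined.
\<close>

record 'c link_diagram =
  crossings :: "'c set"
  overs :: "'c \<Rightarrow> corner set"
  glue :: "'c \<times> corner \<Rightarrow> 'c \<times> corner"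

definition ends :: "'c link_diagram \<Rightarrow> ('c \<times> corner) set" where
  "ends D = crossings D \<times> UNIV"

definition wf_diagram :: "'c link_diagram \<Rightarrow> bool" where
  "wf_diagram D \<longleftrightarrow> finite (crossings D) \<and>
    (\<forall>c\<in>crossings D. overs D c \<in> {{NW, SE}, {NE, SW}}) \<and>
    (\<forall>e\<in>ends D. glue D e \<in> ends D \<and> glue D e \<noteq> e \<and> glue D (glue D e) = e)"

text \<open>
  An orientation is given by the set of those crossing ends at which the oriented link leaves
  the crossing.
\<close>

definition is_orientation :: "'c link_diagram \<Rightarrow> ('c \<times> corner) set \<Rightarrow> bool" where
  "is_orientation D out \<longleftrightarrow> out \<subseteq> ends D \<and>
    (\<forall>c\<in>crossings D. \<forall>d. (c, opposite d) \<in> out \<longleftrightarrow> (c, d) \<notin> out) \<and>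
    (\<forall>e\<in>ends D. glue D e \<in> out \<longleftrightarrow> e \<notin> out)"

text \<open>Arcs run along edges and over crossings; an arc is the set of all crossing ends on it.\<close>

definition arc_step :: "'c link_diagram \<Rightarrow> (('c \<times> corner) \<times> ('c \<times> corner)) set" where
  "arc_step D = {(e, glue D e) | e. e \<in> ends D} \<union>
    {((c, d), (c, opposite d)) | c d. c \<in> crossings D \<and> d \<in> overs D c}"

definition arc_of :: "'c link_diagram \<Rightarrow> 'c \<times> corner \<Rightarrow> ('c \<times> corner) set" where
  "arc_of D e = {e'. (e, e') \<in> (arc_step D \<union> (arc_step D)\<inverse>)\<^sup>*}"

definition arcs :: "'c link_diagram \<Rightarrow> ('c \<times> corner) set set" where
  "arcs D = arc_of D ` ends D"

text \<open>
  If \<open>(c, d)\<close> is the end at which the overcrossing strand leaves \<open>c\<close> and that strand is viewed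
  as pointing up, then \<open>ccw d\<close> is on its left and \<open>opposite (ccw d)\<close> on its right.
\<close>

definition crossing_relations ::
    "'c link_diagram \<Rightarrow> ('c \<times> corner) set \<Rightarrow>
      (('c \<times> corner) set qterm \<times> ('c \<times> corner) set qterm) set" where
  "crossing_relations D out =
    {(Gen (arc_of D (c, ccw d)),
      Act (Gen (arc_of D (c, opposite (ccw d)))) (Gen (arc_of D (c, d)))) | c d.
      c \<in> crossings D \<and> d \<in> overs D c \<and> (c, d) \<in> out}"

definition fundamental_quandle ::
    "'c link_diagram \<Rightarrow> ('c \<times> corner) set \<Rightarrow> ('c \<times> corner) set qterm set quandle_struct" where
  "fundamental_quandle D out = presented_quandle (arcs D) (crossing_relations D out)"


section \<open>Pretzel links\<close>

text \<open>
  The diagram for a list of nonzero integers.  Crossing \<open>(i, j)\<close> is the \<open>j\<close>-th crossing from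
  the top in the \<open>i\<close>-th column, both counted from 0.  All overcrossing strands of a column
  have the same slope, which is what makes the column a twist of its two strands.
  The choice of slope for positive entries is a convention; the other one gives the mirror image.
\<close>

definition pretzel_size :: "int list \<Rightarrow> nat \<Rightarrow> nat" where
  "pretzel_size ps i = nat \<bar>ps ! i\<bar>"

fun pretzel_glue :: "int list \<Rightarrow> (nat \<times> nat) \<times> corner \<Rightarrow> (nat \<times> nat) \<times> corner" where
  "pretzel_glue ps ((i, j), NW) =
    (if j > 0 then ((i, j - 1), SW)
     else (((i + length ps - 1) mod length ps, 0), NE))"
| "pretzel_glue ps ((i, j), NE) =
    (if j > 0 then ((i, j - 1), SE)
     else (((i + 1) mod length ps, 0), NW))"
| "pretzel_glue ps ((i, j), SW) =
    (if j + 1 < pretzel_size ps i then ((i, j + 1), NW)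
     else (let i' = (i + length ps - 1) mod length ps in ((i', pretzel_size ps i' - 1), SE)))"
| "pretzel_glue ps ((i, j), SE) =
    (if j + 1 < pretzel_size ps i then ((i, j + 1), NE)
     else (let i' = (i + 1) mod length ps in ((i', pretzel_size ps i' - 1), SW)))"

definition pretzel :: "int list \<Rightarrow> (nat \<times> nat) link_diagram" where
  "pretzel ps =
    \<lparr>crossings = (SIGMA i:{..<length ps}. {..<pretzel_size ps i}),
     overs = (\<lambda>(i, j). if ps ! i > 0 then {NE, SW} else {NW, SE}),
     glue = pretzel_glue ps\<rparr>"

lemma wf_diagram_pretzel:
  assumes "0 \<notin> set ps"
  shows "wf_diagram (pretzel ps)"
proof -
  let ?m = "length ps"
  have pos: "pretzel_size ps i > 0" if "i < ?m" for i
    using assms nth_mem[OF that] by (cases "ps ! i = 0") (simp_all add: pretzel_size_def)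
  have lr: "((i + ?m - Suc 0) mod ?m + 1) mod ?m = i" "((i + 1) mod ?m + ?m - Suc 0) mod ?m = i"
    if "i < ?m" for i
  proof -
    have "Suc (i + ?m - Suc 0) = i + ?m"
      using that by simp
    then show "((i + ?m - Suc 0) mod ?m + 1) mod ?m = i"
      using that by (simp add: mod_simps)
    show "((i + 1) mod ?m + ?m - Suc 0) mod ?m = i"
      using that by (cases "i + 1 = ?m") simp_all
  qed
  have "pretzel_glue ps e \<in> ends (pretzel ps) \<and> pretzel_glue ps e \<noteq> e
      \<and> pretzel_glue ps (pretzel_glue ps e) = e" if e: "e \<in> ends (pretzel ps)" for e
  proof -
    obtain i j d where ijd: "e = ((i, j), d)" "i < ?m" "j < pretzel_size ps i"
      using e by (cases e) (auto simp: ends_def pretzel_def)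
    have m: "k mod ?m < ?m" for k
      using ijd by (intro mod_less_divisor) linarith
    have *: "pretzel_size ps (k mod ?m) > 0" for k
      using pos m by blast
    show ?thesis
      using ijd lr[OF ijd(2)] m *
      by (cases d) (auto simp: ends_def pretzel_def Let_def)
  qed
  then show ?thesis
    by (auto simp: wf_diagram_def pretzel_def ends_def)
qed

end

theory Submission
  imports Defs
begin

text \<open>
  A homomorphism from a quandle given by generators and relations is the same thing as an
  assignment of values to the generators that satisfies the relations
  (\<open>bij_betw_Hom_presented\<close>).  For the fundamental quandle of a diagram this turns the
  homomorphisms into colourings of the arcs, and for a dihedral quandle into solutions of one
  linear congruence per crossing: the colours of the two undercrossing arcs add up to twice the
  colour of the overcrossing arc (\<open>end_colourings_dihedral\<close>).  Since this congruence treats the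
  two sides of the overcrossing strand alike, the orientation has no influence.

  In a pretzel diagram with columns \<open>q\<^sub>0, \<dots>, q\<^sub>m\<^sub>-\<^sub>1\<close> let \<open>x\<^sub>i\<close> be the colour at the top left of
  column \<open>i\<close>; because of the closing arcs, the colour at its top right is \<open>x\<^sub>i\<^sub>+\<^sub>1\<close>, with indices
  modulo \<open>m\<close>.  A crossing preserves the difference \<open>d\<^sub>i = x\<^sub>i\<^sub>+\<^sub>1 - x\<^sub>i\<close> of the two colours of the
  column and shifts both of them by \<open>d\<^sub>i\<close> or \<open>-d\<^sub>i\<close>, depending on its sign.  So at the bottom the
  colours are \<open>x\<^sub>i + q\<^sub>i d\<^sub>i\<close> and \<open>x\<^sub>i\<^sub>+\<^sub>1 + q\<^sub>i d\<^sub>i\<close>, and the bottom arcs match precisely if all the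
  products \<open>q\<^sub>i d\<^sub>i\<close> are congruent to one common value \<open>c\<close>
  (\<open>bij_betw_twist_vectors_fox_colourings\<close>).

  Instead of the \<open>x\<^sub>i\<close> one can choose \<open>x\<^sub>0\<close>, in \<open>n\<close> ways, and differences \<open>d\<^sub>i\<close> with sum \<open>0\<close>
  (\<open>card_twist_vectors\<close>).  Let \<open>n\<close> be prime.  If \<open>k > 0\<close> of the \<open>q\<^sub>i\<close> vanish modulo \<open>n\<close>, then \<open>c\<close>
  vanishes, so only the \<open>k\<close> differences at these places can be nonzero, and their sum being \<open>0\<close> is
  the only condition on them: there are \<open>n\<^sup>k\<close> colourings.  If no \<open>q\<^sub>i\<close> vanishes, then
  \<open>d\<^sub>i = c / q\<^sub>i\<close>, and \<open>c\<close> is subject to the condition that \<open>c\<close> times the sum of the \<open>1 / q\<^sub>i\<close> is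
  \<open>0\<close>.  After clearing denominators this sum is the elementary symmetric polynomial of degree
  \<open>m - 1\<close>, so there are \<open>n\<^sup>2\<close> colourings if it vanishes and \<open>n\<close> otherwise (\<open>card_Hom_pretzel\<close>).

  For the columns \<open>p\<^sub>1, -p\<^sub>2, p\<^sub>3, -p\<^sub>4\<close> this polynomial is \<open>h\<close>.  It is nonzero if exactly one \<open>p\<^sub>i\<close>
  vanishes modulo \<open>n\<close>, and zero if at least two do, which matches the count by \<open>k\<close> with the cases
  of the theorem.
\<close>

section \<open>Homomorphisms out of a presented quandle\<close>

text \<open>
  The inverse in the last equation is meaningful on the carrier, where the action of a quandle
  element is a bijection.
\<close>

primrec eval_qterm :: "('b, 'u) quandle_struct_scheme \<Rightarrow> ('a \<Rightarrow> 'b) \<Rightarrow> 'a qterm \<Rightarrow> 'b" where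
  "eval_qterm X g (Gen a) = g a"
| "eval_qterm X g (Act s t) = eval_qterm X g s \<triangleright>\<^bsub>X\<^esub> eval_qterm X g t"
| "eval_qterm X g (ActInv s t) =
    inv_into (carrier X) (\<lambda>x. x \<triangleright>\<^bsub>X\<^esub> eval_qterm X g t) (eval_qterm X g s)"

context quandle
begin

lemma act_inv_into:
  assumes "x \<in> carrier X" "y \<in> carrier X"
  shows "inv_into (carrier X) (\<lambda>z. z \<triangleright> y) x \<in> carrier X"
    and "inv_into (carrier X) (\<lambda>z. z \<triangleright> y) x \<triangleright> y = x"
    and "inv_into (carrier X) (\<lambda>z. z \<triangleright> y) (x \<triangleright> y) = x"
proof -
  have im: "(\<lambda>z. z \<triangleright> y) ` carrier X = carrier X" and inj: "inj_on (\<lambda>z. z \<triangleright> y) (carrier X)"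
    using act_bij[OF assms(2)] by (auto simp: bij_betw_def)
  show "inv_into (carrier X) (\<lambda>z. z \<triangleright> y) x \<in> carrier X"
    using assms(1) im by (intro inv_into_into) simp
  show "inv_into (carrier X) (\<lambda>z. z \<triangleright> y) x \<triangleright> y = x"
    using assms(1) im by (intro f_inv_into_f[where f = "\<lambda>z. z \<triangleright> y"]) simp
  show "inv_into (carrier X) (\<lambda>z. z \<triangleright> y) (x \<triangleright> y) = x"
    using inj assms(1) by (rule inv_into_f_f)
qed

lemma eval_qterm_closed:
  assumes "g \<in> A \<rightarrow> carrier X" "t \<in> qterms A"
  shows "eval_qterm X g t \<in> carrier X"
  using assms(2) by (induction t) (use assms(1) in \<open>auto intro: act_closed act_inv_into\<close>)

text \<open>
  Well-definedness on classes: the defining rules of \<open>qeq\<close> are the given relations, closure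
  properties, and the quandle axioms, which hold in \<open>X\<close>.
\<close>

lemma eval_qterm_qeq:
  assumes g: "g \<in> A \<rightarrow> carrier X"
    and R: "\<And>s t. (s, t) \<in> R \<Longrightarrow> eval_qterm X g s = eval_qterm X g t"
    and "qeq A R s t"
  shows "eval_qterm X g s = eval_qterm X g t"
  using assms(3)
proof (induction rule: qeq.induct)
  case (qeq_distrib s t u)
  then show ?case
    by (simp add: act_distrib eval_qterm_closed[OF g])
qed (simp_all add: R act_idem act_inv_into eval_qterm_closed[OF g])

text \<open>
  A homomorphism is only required to respect the action; that it also respects the inverse
  action follows from injectivity of the action in \<open>X\<close>.
\<close>

lemma hom_eq_eval_qterm:
  assumes \<phi>: "\<phi> \<in> quandle_Hom (presented_quandle A R) X" and "t \<in> qterms A"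
  shows "\<phi> (qeq_rel A R `` {t}) = eval_qterm X (\<lambda>a. \<phi> (qeq_rel A R `` {Gen a})) t"
proof -
  let ?c = "\<lambda>t. qeq_rel A R `` {t}"
  have cl: "?c t \<in> carrier (presented_quandle A R)" if "t \<in> qterms A" for t
    using that by (auto simp: presented_quandle_def quotient_def)
  have act: "\<phi> (?c (Act s t)) = \<phi> (?c s) \<triangleright> \<phi> (?c t)" if "s \<in> qterms A" "t \<in> qterms A" for s t
  proof -
    have "\<phi> (?c s \<triangleright>\<^bsub>presented_quandle A R\<^esub> ?c t) = \<phi> (?c s) \<triangleright> \<phi> (?c t)"
      using \<phi> cl that by (simp add: quandle_Hom_def)
    then show ?thesis
      using that by (simp add: presented_act_class)
  qed
  have val: "\<phi> (?c t) \<in> carrier X" if "t \<in> qterms A" for t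
    using \<phi> cl[OF that] by (auto simp: quandle_Hom_def)
  show ?thesis
    using assms(2)
  proof (induction t)
    case (ActInv s t)
    have "?c (Act (ActInv s t) t) = ?c s"
      using ActInv.prems qeq_Act_ActInv[of s A t R] by (simp add: qeq_class_eq_iff)
    then have "\<phi> (?c s) = \<phi> (?c (ActInv s t)) \<triangleright> \<phi> (?c t)"
      using act[of "ActInv s t" t] ActInv.prems by simp
    then have "inv_into (carrier X) (\<lambda>z. z \<triangleright> \<phi> (?c t)) (\<phi> (?c s)) = \<phi> (?c (ActInv s t))"
      using act_inv_into(3)[of "\<phi> (?c (ActInv s t))" "\<phi> (?c t)"] val ActInv.prems by simp
    then show ?case
      using ActInv by simp
  qed (simp_all add: act)
qed

text \<open>
  The universal property of the presentation.  For surjectivity, an assignment that satisfies the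
  relations is extended to terms by evaluation, which is constant on classes.
\<close>

lemma bij_betw_Hom_presented:
  assumes R: "R \<subseteq> qterms A \<times> qterms A"
  shows "bij_betw (\<lambda>\<phi>. \<lambda>a\<in>A. \<phi> (qeq_rel A R `` {Gen a}))
    (quandle_Hom (presented_quandle A R) X)
    {g \<in> A \<rightarrow>\<^sub>E carrier X. \<forall>(s, t)\<in>R. eval_qterm X g s = eval_qterm X g t}"
    (is "bij_betw ?\<Phi> ?H ?G")
proof -
  let ?c = "\<lambda>t. qeq_rel A R `` {t}"
  let ?Q = "presented_quandle A R"
  have carr: "carrier ?Q = ?c ` qterms A"
    by (auto simp: presented_quandle_def quotient_def)
  have eval_restrict: "eval_qterm X (restrict g A) t = eval_qterm X g t" if "t \<in> qterms A"
    for g and t :: "'c qterm"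
    using that by (induction t) auto
  have hom: "\<phi> (?c t) = eval_qterm X (?\<Phi> \<phi>) t" if "\<phi> \<in> ?H" "t \<in> qterms A" for \<phi> t
    using hom_eq_eval_qterm[OF that] that(2) by (simp add: eval_restrict)
  have "inj_on ?\<Phi> ?H"
  proof (rule inj_onI)
    fix \<phi> \<psi> assume *: "\<phi> \<in> ?H" "\<psi> \<in> ?H" "?\<Phi> \<phi> = ?\<Phi> \<psi>"
    have "\<phi> C = \<psi> C" if "C \<in> carrier ?Q" for C
    proof -
      obtain t where "t \<in> qterms A" "C = ?c t"
        using \<open>C \<in> carrier ?Q\<close> carr by auto
      then show ?thesis
        using * hom by metis
    qed
    moreover have "\<phi> \<in> extensional (carrier ?Q)" "\<psi> \<in> extensional (carrier ?Q)"
      using * by (auto simp: quandle_Hom_def PiE_def)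
    ultimately show "\<phi> = \<psi>"
      by (metis extensionalityI)
  qed
  moreover have "?\<Phi> \<phi> \<in> ?G" if \<phi>: "\<phi> \<in> ?H" for \<phi>
  proof -
    have "?\<Phi> \<phi> \<in> A \<rightarrow>\<^sub>E carrier X"
      using \<phi> by (auto simp: quandle_Hom_def carr)
    moreover have "eval_qterm X (?\<Phi> \<phi>) s = eval_qterm X (?\<Phi> \<phi>) t" if st: "(s, t) \<in> R" for s t
    proof -
      have "s \<in> qterms A" "t \<in> qterms A"
        using R st by auto
      moreover from this have "?c s = ?c t"
        using st by (simp add: qeq_class_eq_iff qeq_base)
      ultimately show ?thesis
        using hom[OF \<phi>] by metis
    qed
    ultimately show ?thesis
      by auto
  qed
  moreover have "g \<in> ?\<Phi> ` ?H" if g: "g \<in> ?G" for g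
  proof -
    have gA: "g \<in> A \<rightarrow> carrier X"
      using g by auto
    define \<phi> where "\<phi> = (\<lambda>C\<in>carrier ?Q. eval_qterm X g (SOME t. t \<in> C))"
    have \<phi>: "\<phi> (?c t) = eval_qterm X g t" if t: "t \<in> qterms A" for t
    proof -
      have "t \<in> ?c t"
        using t by (simp add: qeq_rel_def qeq_refl)
      then have "(SOME t'. t' \<in> ?c t) \<in> ?c t"
        by (rule someI)
      then have "qeq A R t (SOME t'. t' \<in> ?c t)"
        by (simp add: qeq_rel_def)
      then have "eval_qterm X g t = eval_qterm X g (SOME t'. t' \<in> ?c t)"
        by (rule eval_qterm_qeq[OF gA, rotated]) (use g in auto)
      then show ?thesis
        using t by (simp add: \<phi>_def carr)
    qed
    have "\<phi> \<in> ?H"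
      by (auto simp: quandle_Hom_def carr \<phi> presented_act_class eval_qterm_closed[OF gA])
        (simp add: \<phi>_def carr)
    moreover have "?\<Phi> \<phi> = g"
      using g by (auto simp: \<phi> fun_eq_iff PiE_def extensional_def)
    ultimately show ?thesis
      by blast
  qed
  ultimately show ?thesis
    unfolding bij_betw_def by blast
qed

end


section \<open>Colourings of a link diagram\<close>

text \<open>
  The colour of an arc is recorded at each crossing end on it.  A colouring is then a function on
  crossing ends, for which the sets of ends that form the arcs need not be determined.
\<close>

definition end_colourings ::
    "'c link_diagram \<Rightarrow> ('c \<times> corner) set \<Rightarrow> ('b, 'u) quandle_struct_scheme \<Rightarrow>
      ('c \<times> corner \<Rightarrow> 'b) set" where
  "end_colourings D out X = {f \<in> ends D \<rightarrow>\<^sub>E carrier X.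
     (\<forall>(e, e')\<in>arc_step D. f e = f e') \<and>
     (\<forall>c d. c \<in> crossings D \<and> d \<in> overs D c \<and> (c, d) \<in> out \<longrightarrow>
       f (c, ccw d) = f (c, opposite (ccw d)) \<triangleright>\<^bsub>X\<^esub> f (c, d))}"

lemma arc_of_eq_iff: "arc_of D e = arc_of D e' \<longleftrightarrow> e' \<in> arc_of D e"
proof -
  let ?r = "(arc_step D \<union> (arc_step D)\<inverse>)\<^sup>*"
  have "sym ?r"
    by (intro sym_rtrancl) (auto simp: sym_def)
  then have "(e, e') \<in> ?r \<longleftrightarrow> ?r `` {e} = ?r `` {e'}"
    by (smt (verit, ccfv_threshold) Image_singleton_iff rtrancl.rtrancl_refl rtrancl_trans
        subsetI subset_antisym symD)
  then show ?thesis
    by (auto simp: arc_of_def Image_def)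
qed

lemma arc_of_self: "e \<in> arc_of D e"
  by (simp add: arc_of_def)

lemma arc_step_arc_of: "(e, e') \<in> arc_step D \<Longrightarrow> arc_of D e = arc_of D e'"
  unfolding arc_of_eq_iff by (auto simp: arc_of_def)

lemma ends_iff [simp]: "(c, d) \<in> ends D \<longleftrightarrow> c \<in> crossings D"
  by (simp add: ends_def)

lemma arc_step_ends:
  assumes "wf_diagram D" "(e, e') \<in> arc_step D"
  shows "e \<in> ends D \<and> e' \<in> ends D"
  using assms by (auto simp: arc_step_def wf_diagram_def)

lemma arc_of_colour_eq:
  assumes "\<forall>(e, e')\<in>arc_step D. f e = f e'" "e' \<in> arc_of D e"
  shows "f e' = f e"
proof -
  have "(e, e') \<in> (arc_step D \<union> (arc_step D)\<inverse>)\<^sup>*"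
    using assms(2) by (simp add: arc_of_def)
  then show ?thesis
    by induction (use assms(1) in auto)
qed

lemma arc_of_subset_ends:
  assumes "wf_diagram D" "e \<in> ends D"
  shows "arc_of D e \<subseteq> ends D"
proof
  fix e' assume "e' \<in> arc_of D e"
  then have "(e, e') \<in> (arc_step D \<union> (arc_step D)\<inverse>)\<^sup>*"
    by (simp add: arc_of_def)
  then show "e' \<in> ends D"
    by induction (use assms(2) arc_step_ends[OF assms(1)] in blast)+
qed

text \<open>
  A function on arcs corresponds to a function on crossing ends that is constant along arcs, and
  constancy along arcs amounts to constancy along each single step.
\<close>

theorem card_Hom_fundamental_quandle:
  assumes wf: "wf_diagram D" and X: "quandle X"
  shows "card (quandle_Hom (fundamental_quandle D out) X) = card (end_colourings D out X)"
proof -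
  let ?R = "crossing_relations D out"
  let ?G = "{g \<in> arcs D \<rightarrow>\<^sub>E carrier X. \<forall>(s, t)\<in>?R. eval_qterm X g s = eval_qterm X g t}"
  let ?\<Phi> = "\<lambda>g. \<lambda>e\<in>ends D. g (arc_of D e)"
  have arcs: "arc_of D e \<in> arcs D" if "e \<in> ends D" for e
    using that by (simp add: arcs_def)
  have "?R \<subseteq> qterms (arcs D) \<times> qterms (arcs D)"
    by (auto simp: crossing_relations_def arcs)
  then have 1: "card (quandle_Hom (fundamental_quandle D out) X) = card ?G"
    unfolding fundamental_quandle_def
    using quandle.bij_betw_Hom_presented[OF X] bij_betw_same_card by blast
  have "inj_on ?\<Phi> ?G"
  proof (rule inj_onI)
    fix g g' assume *: "g \<in> ?G" "g' \<in> ?G" "?\<Phi> g = ?\<Phi> g'"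
    have "g a = g' a" if "a \<in> arcs D" for a
    proof -
      obtain e where e: "e \<in> ends D" "a = arc_of D e"
        using \<open>a \<in> arcs D\<close> by (auto simp: arcs_def)
      have "?\<Phi> g e = ?\<Phi> g' e"
        using *(3) by (rule fun_cong)
      then show ?thesis
        using e by simp
    qed
    then show "g = g'"
      using *(1,2) by (intro PiE_ext[of g "arcs D" "\<lambda>_. carrier X" g']) simp_all
  qed
  moreover have "?\<Phi> g \<in> end_colourings D out X" if g: "g \<in> ?G" for g
  proof -
    have "?\<Phi> g \<in> ends D \<rightarrow>\<^sub>E carrier X"
      using g arcs by auto
    moreover have "?\<Phi> g e = ?\<Phi> g e'" if "(e, e') \<in> arc_step D" for e e'
      using arc_step_ends[OF wf that] arc_step_arc_of[OF that] by simp
    moreover have "g (arc_of D (c, ccw d)) =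
        g (arc_of D (c, opposite (ccw d))) \<triangleright>\<^bsub>X\<^esub> g (arc_of D (c, d))"
      if "c \<in> crossings D" "d \<in> overs D c" "(c, d) \<in> out" for c d
    proof -
      have "(Gen (arc_of D (c, ccw d)),
          Act (Gen (arc_of D (c, opposite (ccw d)))) (Gen (arc_of D (c, d)))) \<in> ?R"
        using that by (auto simp: crossing_relations_def)
      then show ?thesis
        using g by fastforce
    qed
    ultimately show ?thesis
      by (auto simp: end_colourings_def)
  qed
  moreover have "f \<in> ?\<Phi> ` ?G" if f: "f \<in> end_colourings D out X" for f
  proof -
    define g where "g = (\<lambda>a\<in>arcs D. f (SOME e. e \<in> a))"
    have const: "\<forall>(e, e')\<in>arc_step D. f e = f e'"
      using f by (simp add: end_colourings_def)
    have g: "g (arc_of D e) = f e" if "e \<in> ends D" for e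
    proof -
      have "(SOME e'. e' \<in> arc_of D e) \<in> arc_of D e"
        by (rule someI) (rule arc_of_self)
      then show ?thesis
        using arc_of_colour_eq[OF const] that by (simp add: g_def arcs)
    qed
    have "g \<in> arcs D \<rightarrow>\<^sub>E carrier X"
    proof (rule PiE_I)
      show "g a \<in> carrier X" if "a \<in> arcs D" for a
        using that f by (auto simp: arcs_def g end_colourings_def)
    qed (simp add: g_def)
    moreover have "eval_qterm X g s = eval_qterm X g t" if "(s, t) \<in> ?R" for s t
      using that f by (auto simp: crossing_relations_def g end_colourings_def)
    ultimately have "g \<in> ?G"
      by auto
    moreover have "?\<Phi> g = f"
      using f by (auto simp: g fun_eq_iff end_colourings_def PiE_def extensional_def)
    ultimately show ?thesis
      by blast
  qed
  ultimately have "bij_betw ?\<Phi> ?G (end_colourings D out X)"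
    by (auto simp: bij_betw_def)
  then show ?thesis
    using 1 by (simp add: bij_betw_same_card)
qed

text \<open>
  The classical Fox colourings of an unoriented diagram.
\<close>

definition fox_colourings :: "nat \<Rightarrow> 'c link_diagram \<Rightarrow> ('c \<times> corner \<Rightarrow> int) set" where
  "fox_colourings n D = {f \<in> ends D \<rightarrow>\<^sub>E {0..<int n}.
     (\<forall>e\<in>ends D. f (glue D e) = f e) \<and>
     (\<forall>c\<in>crossings D. \<forall>d\<in>overs D c. f (c, opposite d) = f (c, d) \<and>
       [f (c, ccw d) + f (c, opposite (ccw d)) = 2 * f (c, d)] (mod int n))}"

text \<open>
  Reversing the overcrossing strand exchanges its two sides, under which
  \<open>f (c, ccw d) + f (c, opposite (ccw d)) = 2 * f (c, d)\<close> is invariant.  So the relation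
  required at the outgoing end of this strand implies the one at its incoming end.
\<close>

lemma end_colourings_dihedral:
  assumes wf: "wf_diagram D" and out: "is_orientation D out"
  shows "end_colourings D out (dihedral_quandle n) = fox_colourings n D"
proof -
  have over_opp: "opposite d \<in> overs D c" if "c \<in> crossings D" "d \<in> overs D c" for c d
  proof -
    have "overs D c = {NW, SE} \<or> overs D c = {NE, SW}"
      using wf \<open>c \<in> crossings D\<close> unfolding wf_diagram_def by blast
    then show ?thesis
      using \<open>d \<in> overs D c\<close> by fastforce
  qed
  have ccw_opp: "ccw (opposite d) = opposite (ccw d)" "opposite (opposite d) = d" for d
    by (cases d; simp)+
  have act_iff: "a = (2 * y - b) mod int n \<longleftrightarrow> [a + b = 2 * y] (mod int n)"
    if "a \<in> {0..<int n}" for a b y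
  proof -
    have "a = (2 * y - b) mod int n \<longleftrightarrow> [a = 2 * y - b] (mod int n)"
      using that by (simp add: cong_def)
    then show ?thesis
      by (simp add: cong_iff_dvd_diff algebra_simps)
  qed
  have steps: "(\<forall>(e, e')\<in>arc_step D. f e = f e') \<longleftrightarrow>
      (\<forall>e\<in>ends D. f (glue D e) = f e) \<and>
      (\<forall>c\<in>crossings D. \<forall>d\<in>overs D c. f (c, opposite d) = f (c, d))"
    (is "?L \<longleftrightarrow> ?R") for f :: "'a \<times> corner \<Rightarrow> int"
  proof
    assume L: ?L
    have "f (glue D e) = f e" if "e \<in> ends D" for e
    proof -
      have "(e, glue D e) \<in> arc_step D"
        using that unfolding arc_step_def by blast
      then show ?thesis
        using L by auto
    qed
    moreover have "f (c, opposite d) = f (c, d)" if "c \<in> crossings D" "d \<in> overs D c" for c d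
    proof -
      have "((c, d), (c, opposite d)) \<in> arc_step D"
        using that by (auto simp: arc_step_def)
      then show ?thesis
        using L by auto
    qed
    ultimately show ?R
      by blast
  next
    assume R: ?R
    have "f e = f e'" if "(e, e') \<in> arc_step D" for e e'
      using that R unfolding arc_step_def by auto
    then show ?L
      by blast
  qed
  have rel: "(\<forall>c d. c \<in> crossings D \<and> d \<in> overs D c \<and> (c, d) \<in> out \<longrightarrow>
        f (c, ccw d) = (2 * f (c, d) - f (c, opposite (ccw d))) mod int n) \<longleftrightarrow>
      (\<forall>c\<in>crossings D. \<forall>d\<in>overs D c.
        [f (c, ccw d) + f (c, opposite (ccw d)) = 2 * f (c, d)] (mod int n))" (is "?L \<longleftrightarrow> ?R")
    if f: "f \<in> ends D \<rightarrow>\<^sub>E {0..<int n}"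
      and over: "\<forall>c\<in>crossings D. \<forall>d\<in>overs D c. f (c, opposite d) = f (c, d)" for f
  proof -
    have ran: "f (c, d) \<in> {0..<int n}" if "c \<in> crossings D" for c d
      using f that by (auto simp: PiE_iff)
    show ?thesis
    proof
      assume L: ?L
      show ?R
      proof (intro ballI)
        fix c d assume c: "c \<in> crossings D" and d: "d \<in> overs D c"
        show "[f (c, ccw d) + f (c, opposite (ccw d)) = 2 * f (c, d)] (mod int n)"
        proof (cases "(c, d) \<in> out")
          case True
          then show ?thesis
            using L c d act_iff[OF ran[OF c]] by blast
        next
          case False
          then have "(c, opposite d) \<in> out"
            using out c by (auto simp: is_orientation_def)
          then have "f (c, ccw (opposite d)) =
              (2 * f (c, opposite d) - f (c, opposite (ccw (opposite d)))) mod int n"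
            using L c over_opp[OF c d] by blast
          then show ?thesis
            using over c d act_iff[OF ran[OF c]] by (simp add: ccw_opp add.commute)
        qed
      qed
    next
      assume ?R
      then show ?L
        using act_iff[OF ran] by blast
    qed
  qed
  show ?thesis
    unfolding end_colourings_def fox_colourings_def steps
    by (rule Collect_cong) (simp add: dihedral_quandle_def ball_conj_distrib rel cong: conj_cong)
qed


section \<open>Colourings of a pretzel diagram\<close>

text \<open>
  The possible colours at the top left corners of the columns.  The common value \<open>c\<close> is the
  shift that every column produces between its top and its bottom.
\<close>

definition twist_vectors :: "nat \<Rightarrow> int list \<Rightarrow> (nat \<Rightarrow> int) set" where
  "twist_vectors n ps = {x \<in> {..<length ps} \<rightarrow>\<^sub>E {0..<int n}.
     \<exists>c. \<forall>i<length ps. [ps ! i * (x (Suc i mod length ps) - x i) = c] (mod int n)}"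

text \<open>
  The colour that the colours \<open>x\<close> at the top force at every crossing end, before reduction
  modulo \<open>n\<close>: it is \<open>x i\<close> plus a multiple of the difference of column \<open>i\<close>.  The coefficient grows
  by one from the western to the eastern corners, and changes by the sign of the crossings from
  the northern to the southern ones.
\<close>

definition pretzel_colour :: "int list \<Rightarrow> (nat \<Rightarrow> int) \<Rightarrow> (nat \<times> nat) \<times> corner \<Rightarrow> int" where
  "pretzel_colour ps x = (\<lambda>((i, j), d).
     x i + (of_bool (d \<in> {NE, SE}) + sgn (ps ! i) * (int j + of_bool (d \<in> {SW, SE})))
       * (x (Suc i mod length ps) - x i))"

lemma mod_less_of_less: "i < m \<Longrightarrow> k mod m < (m :: nat)"
  by simp

lemma Suc_pred_mod: "i < m \<Longrightarrow> Suc ((i + m - Suc 0) mod m) mod m = i"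
  by (cases i) (simp_all add: mod_Suc_eq)

lemma pretzel_size_pos:
  assumes "0 \<notin> set ps" "i < length ps"
  shows "pretzel_size ps i > 0"
  using assms nth_mem[OF assms(2)] by (cases "ps ! i = 0") (simp_all add: pretzel_size_def)

lemma sgn_mult_pretzel_size: "sgn (ps ! i) * int (pretzel_size ps i) = ps ! i"
  by (simp add: pretzel_size_def sgn_mult_abs)

lemma pretzel_colour_bottom:
  assumes "Suc j = pretzel_size ps i"
  shows "pretzel_colour ps x ((i, j), SW) = x i + ps ! i * (x (Suc i mod length ps) - x i)"
    and "pretzel_colour ps x ((i, j), SE) =
      x (Suc i mod length ps) + ps ! i * (x (Suc i mod length ps) - x i)"
proof -
  have "sgn (ps ! i) * (int j + 1) = ps ! i"
    using sgn_mult_pretzel_size[of ps i] assms by (metis of_nat_Suc add.commute)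
  then show "pretzel_colour ps x ((i, j), SW) = x i + ps ! i * (x (Suc i mod length ps) - x i)"
    and "pretzel_colour ps x ((i, j), SE) =
      x (Suc i mod length ps) + ps ! i * (x (Suc i mod length ps) - x i)"
    by (simp_all add: pretzel_colour_def distrib_right)
qed

text \<open>
  Vertically adjacent crossings have equal colours at the joined ends by the form of
  \<open>pretzel_colour\<close>, and so do the arcs at the top.  Only the arcs that join the bottoms of
  neighbouring columns need the hypothesis on \<open>x\<close>.
\<close>

lemma pretzel_colour_glue:
  assumes ps: "0 \<notin> set ps" and i: "i < length ps" and j: "j < pretzel_size ps i"
    and c: "\<And>i. i < length ps \<Longrightarrow>
      [ps ! i * (x (Suc i mod length ps) - x i) = c] (mod int n)"
  shows "[pretzel_colour ps x (pretzel_glue ps ((i, j), d)) = pretzel_colour ps x ((i, j), d)]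
    (mod int n)"
proof -
  let ?m = "length ps"
  define l where "l = (i + ?m - Suc 0) mod ?m"
  define r where "r = Suc i mod ?m"
  have l: "l < ?m" "Suc l mod ?m = i"
    using Suc_pred_mod[OF i] mod_less_of_less[OF i] by (simp_all add: l_def)
  have r: "r < ?m"
    using mod_less_of_less[OF i] by (simp add: r_def)
  have bottom: "Suc (pretzel_size ps k - Suc 0) = pretzel_size ps k" if "k < ?m" for k
    using pretzel_size_pos[OF ps that] by simp
  show ?thesis
  proof (cases d)
    case NW
    then show ?thesis
      using l by (cases j) (simp_all add: pretzel_colour_def algebra_simps flip: l_def)
  next
    case NE
    then show ?thesis
      by (cases j) (simp_all add: pretzel_colour_def algebra_simps flip: r_def)
  next
    case SW
    show ?thesis
    proof (cases "Suc j = pretzel_size ps i")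
      case True
      have "[ps ! l * (x i - x l) = ps ! i * (x (Suc i mod ?m) - x i)] (mod int n)"
        using c[OF l(1)] c[OF i] l(2) by (simp add: cong_def)
      then show ?thesis
        using SW True bottom[OF l(1)] l(2)
        by (simp add: pretzel_colour_bottom Let_def cong_add_lcancel flip: l_def)
    next
      case False
      then show ?thesis
        using SW j by (simp add: pretzel_colour_def algebra_simps)
    qed
  next
    case SE
    show ?thesis
    proof (cases "Suc j = pretzel_size ps i")
      case True
      have "[ps ! r * (x (Suc r mod ?m) - x r) = ps ! i * (x r - x i)] (mod int n)"
        using c[OF r] c[OF i] by (simp add: cong_def r_def)
      then show ?thesis
        using SE True bottom[OF r]
        by (simp add: pretzel_colour_bottom Let_def cong_add_lcancel flip: r_def)
    next
      case False
      then show ?thesis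
        using SE j by (simp add: pretzel_colour_def algebra_simps)
    qed
  qed
qed

lemma pretzel_simps:
  "crossings (pretzel ps) = (SIGMA i:{..<length ps}. {..<pretzel_size ps i})"
  "overs (pretzel ps) (i, j) = (if ps ! i > 0 then {NE, SW} else {NW, SE})"
  "glue (pretzel ps) = pretzel_glue ps"
  by (simp_all add: pretzel_def)

lemma pretzel_colour_crossing:
  assumes "ps ! i \<noteq> 0" "d \<in> overs (pretzel ps) (i, j)"
  shows "pretzel_colour ps x ((i, j), opposite d) = pretzel_colour ps x ((i, j), d)"
    and "pretzel_colour ps x ((i, j), ccw d) + pretzel_colour ps x ((i, j), opposite (ccw d)) =
      2 * pretzel_colour ps x ((i, j), d)"
  using assms by (auto simp: pretzel_simps pretzel_colour_def algebra_simps split: if_splits)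

text \<open>
  The colours at the two upper ends of a crossing determine those at the lower ends, so the top
  colours propagate down each column.
\<close>

lemma fox_colouring_pretzel_eq:
  assumes ps: "0 \<notin> set ps" and f: "f \<in> fox_colourings n (pretzel ps)"
    and x: "\<And>i. i < length ps \<Longrightarrow> x i = f ((i, 0), NW)"
    and i: "i < length ps" and j: "j < pretzel_size ps i"
  shows "[f ((i, j), d) = pretzel_colour ps x ((i, j), d)] (mod int n)"
proof -
  let ?F = "\<lambda>j d. pretzel_colour ps x ((i, j), d)"
  have nz: "ps ! i \<noteq> 0"
    using ps i nth_mem by metis
  have glue: "f (pretzel_glue ps ((i, j), d)) = f ((i, j), d)" if "j < pretzel_size ps i" for j d
    using f i that by (simp add: fox_colourings_def pretzel_simps)
  have top_to_all: "[f ((i, j), d) = ?F j d] (mod int n)"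
    if j: "j < pretzel_size ps i" and NW: "[f ((i, j), NW) = ?F j NW] (mod int n)"
      and NE: "[f ((i, j), NE) = ?F j NE] (mod int n)" for j d
  proof -
    have over: "f ((i, j), opposite d) = f ((i, j), d)"
      and under: "[f ((i, j), ccw d) + f ((i, j), opposite (ccw d)) = 2 * f ((i, j), d)] (mod int n)"
      if "d \<in> overs (pretzel ps) (i, j)" for d
      using f i j that by (auto simp: fox_colourings_def pretzel_simps(1))
    \<comment> \<open>Solves the crossing congruence for the colour of the lower undercrossing end.\<close>
    have solve: "[b = 2 * y' - a'] (mod int n)"
      if "[a + b = 2 * y] (mod int n)" "[a = a'] (mod int n)" "[y = y'] (mod int n)"
      for a b y a' y' :: int
    proof -
      have "[(a + b) - a = 2 * y' - a'] (mod int n)"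
        using that cong_trans cong_scalar_left cong_diff by metis
      then show ?thesis
        by simp
    qed
    have "[f ((i, j), SW) = ?F j SW] (mod int n) \<and> [f ((i, j), SE) = ?F j SE] (mod int n)"
    proof (cases "ps ! i > 0")
      case True
      then have d: "NE \<in> overs (pretzel ps) (i, j)"
        by (simp add: pretzel_simps)
      have "[f ((i, j), SE) = 2 * ?F j NE - ?F j NW] (mod int n)"
        using under[OF d] NW NE by (intro solve) simp_all
      moreover have "2 * ?F j NE - ?F j NW = ?F j SE"
        using pretzel_colour_crossing(2)[OF nz d, of x] by simp
      ultimately show ?thesis
        using over[OF d] NE pretzel_colour_crossing(1)[OF nz d, of x] by simp
    next
      case False
      then have d: "NW \<in> overs (pretzel ps) (i, j)"
        by (simp add: pretzel_simps)
      have "[f ((i, j), SW) = 2 * ?F j NW - ?F j NE] (mod int n)"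
        using under[OF d] NW NE by (intro solve) (simp_all add: add.commute)
      moreover have "2 * ?F j NW - ?F j NE = ?F j SW"
        using pretzel_colour_crossing(2)[OF nz d, of x] by simp
      ultimately show ?thesis
        using over[OF d] NW pretzel_colour_crossing(1)[OF nz d, of x] by simp
    qed
    then show ?thesis
      using NW NE by (cases d) auto
  qed
  show ?thesis
    using j
  proof (induction j arbitrary: d)
    case 0
    have "f ((i, 0), NE) = x (Suc i mod length ps)"
      using glue[OF 0, of NE] x[OF mod_less_of_less[OF i]] by simp
    moreover have "f ((i, 0), NW) = x i"
      using x[OF i] by simp
    ultimately show ?case
      by (intro top_to_all[OF 0, of d]) (simp_all add: pretzel_colour_def)
  next
    case (Suc j)
    have "f ((i, Suc j), NW) = f ((i, j), SW)" "f ((i, Suc j), NE) = f ((i, j), SE)"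
      using glue[OF Suc.prems, of NW] glue[OF Suc.prems, of NE] by simp_all
    moreover have "?F (Suc j) NW = ?F j SW" "?F (Suc j) NE = ?F j SE"
      by (simp_all add: pretzel_colour_def algebra_simps)
    ultimately show ?case
      using Suc.IH Suc.prems by (auto intro: top_to_all[of "Suc j" d])
  qed
qed

text \<open>
  A colouring is determined by its top colours according to \<open>fox_colouring_pretzel_eq\<close>.
  That these form a twist vector is read off from the arcs joining the column bottoms: each gives
  the congruence for a pair of neighbouring columns, and together they give a common value.
\<close>

lemma bij_betw_twist_vectors_fox_colourings:
  assumes ps: "0 \<notin> set ps" and n: "n > 0"
  shows "bij_betw (\<lambda>x. \<lambda>e\<in>ends (pretzel ps). pretzel_colour ps x e mod int n)
    (twist_vectors n ps) (fox_colourings n (pretzel ps))" (is "bij_betw ?\<Phi> ?T ?C")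
proof -
  let ?m = "length ps"
  let ?E = "ends (pretzel ps)"
  have E: "((i, j), d) \<in> ?E \<longleftrightarrow> i < ?m \<and> j < pretzel_size ps i" for i j d
    by (auto simp: pretzel_simps)
  have nz: "ps ! i \<noteq> 0" if "i < ?m" for i
    using ps that nth_mem by metis
  have x_eq: "?\<Phi> x ((i, 0), NW) = x i" if "x \<in> ?T" "i < ?m" for x i
  proof -
    have "x i \<in> {0..<int n}"
      using that by (auto simp: twist_vectors_def PiE_iff)
    then show ?thesis
      using that pretzel_size_pos[OF ps that(2)] by (simp add: pretzel_simps pretzel_colour_def)
  qed
  have "inj_on ?\<Phi> ?T"
  proof (rule inj_onI)
    fix x y assume *: "x \<in> ?T" "y \<in> ?T" "?\<Phi> x = ?\<Phi> y"
    have "x i = y i" if "i < ?m" for i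
      using x_eq[OF *(1) that] x_eq[OF *(2) that] *(3) by metis
    then show "x = y"
      using *(1,2) unfolding twist_vectors_def
      by (intro PiE_ext[of x "{..<?m}" "\<lambda>_. {0..<int n}" y]) auto
  qed
  moreover have "?\<Phi> x \<in> ?C" if x: "x \<in> ?T" for x
  proof -
    obtain c where c: "\<And>i. i < ?m \<Longrightarrow> [ps ! i * (x (Suc i mod ?m) - x i) = c] (mod int n)"
      using x by (auto simp: twist_vectors_def)
    have "?\<Phi> x (pretzel_glue ps e) = ?\<Phi> x e" if "e \<in> ?E" for e
    proof -
      obtain i j d where e: "e = ((i, j), d)"
        by (metis prod.exhaust)
      have "pretzel_glue ps e \<in> ?E"
        using wf_diagram_pretzel[OF ps] that by (auto simp: wf_diagram_def pretzel_simps(3))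
      then show ?thesis
        using pretzel_colour_glue[OF ps _ _ c, where d = d, of i j] that
        unfolding e by (simp add: E pretzel_simps(1) cong_def)
    qed
    moreover have "?\<Phi> x (c, opposite d) = ?\<Phi> x (c, d) \<and>
        [?\<Phi> x (c, ccw d) + ?\<Phi> x (c, opposite (ccw d)) = 2 * ?\<Phi> x (c, d)] (mod int n)"
      if c: "c \<in> crossings (pretzel ps)" and d: "d \<in> overs (pretzel ps) c" for c d
    proof -
      obtain i j where ij: "c = (i, j)" "i < ?m"
        using c by (auto simp: pretzel_simps)
      have "[?\<Phi> x (c, ccw d) + ?\<Phi> x (c, opposite (ccw d)) = pretzel_colour ps x (c, ccw d) +
          pretzel_colour ps x (c, opposite (ccw d))] (mod int n)"
        using c by (intro cong_add) simp_all
      also have "pretzel_colour ps x (c, ccw d) + pretzel_colour ps x (c, opposite (ccw d)) =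
          2 * pretzel_colour ps x (c, d)"
        using pretzel_colour_crossing(2)[OF nz] d ij by blast
      also have "[2 * pretzel_colour ps x (c, d) = 2 * ?\<Phi> x (c, d)] (mod int n)"
        using c by (intro cong_mult) simp_all
      finally show ?thesis
        using pretzel_colour_crossing(1)[OF nz] c d ij by simp
    qed
    moreover have "?\<Phi> x \<in> ?E \<rightarrow>\<^sub>E {0..<int n}"
      using n by auto
    ultimately show ?thesis
      by (auto simp: fox_colourings_def pretzel_simps(3))
  qed
  moreover have "f \<in> ?\<Phi> ` ?T" if f: "f \<in> ?C" for f
  proof -
    define x where "x = (\<lambda>i\<in>{..<?m}. f ((i, 0), NW))"
    note eq = fox_colouring_pretzel_eq[OF ps f, of x]
    have ran: "f ((i, j), d) \<in> {0..<int n}" if "i < ?m" "j < pretzel_size ps i" for i j d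
    proof -
      have "((i, j), d) \<in> ?E"
        using that E by blast
      then show ?thesis
        using f by (auto simp: fox_colourings_def PiE_iff)
    qed
    have "?\<Phi> x = f"
    proof (rule PiE_ext[of _ ?E "\<lambda>_. {0..<int n}"])
      show "f \<in> ?E \<rightarrow>\<^sub>E {0..<int n}"
        using f by (simp add: fox_colourings_def)
      fix e assume e: "e \<in> ?E"
      obtain i j d where ijd: "e = ((i, j), d)"
        by (metis prod.exhaust)
      show "?\<Phi> x e = f e"
        using eq[of i j d] ran[of i j d] e unfolding ijd by (simp add: pretzel_simps(1) x_def cong_def)
    qed (use n in auto)
    let ?q = "\<lambda>i. ps ! i * (x (Suc i mod ?m) - x i)"
    \<comment> \<open>Compares the two ends of the arc from the bottom of column \<open>i\<close> to that of column \<open>i + 1\<close>.\<close>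
    have step: "[?q (Suc i) = ?q i] (mod int n)" if i: "Suc i < ?m" for i
    proof -
      let ?b = "\<lambda>i. pretzel_size ps i - 1"
      have b: "Suc (?b k) = pretzel_size ps k" if "k < ?m" for k
        using pretzel_size_pos[OF ps that] by simp
      have "((i, ?b i), SE) \<in> ?E"
        using i b[of i] by (simp add: pretzel_simps(1))
      then have "f (pretzel_glue ps ((i, ?b i), SE)) = f ((i, ?b i), SE)"
        using f unfolding fox_colourings_def pretzel_simps(3) by blast
      then have "f ((Suc i, ?b (Suc i)), SW) = f ((i, ?b i), SE)"
        using i b[of i] by (simp add: Let_def)
      moreover have "[f ((Suc i, ?b (Suc i)), SW) = x (Suc i) + ?q (Suc i)] (mod int n)"
        using eq[of "Suc i" "?b (Suc i)" SW] b[OF i] i pretzel_colour_bottom(1)[OF b[OF i], of x]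
        by (simp add: x_def)
      moreover have "[f ((i, ?b i), SE) = x (Suc i) + ?q i] (mod int n)"
        using eq[of i "?b i" SE] b[of i] i pretzel_colour_bottom(2)[OF b[of i], of x]
        by (simp add: x_def)
      ultimately have "[x (Suc i) + ?q (Suc i) = x (Suc i) + ?q i] (mod int n)"
        by (simp add: cong_def)
      then show ?thesis
        using cong_add_lcancel by blast
    qed
    have "[?q i = ?q 0] (mod int n)" if "i < ?m" for i
      using that
    proof (induction i)
      case (Suc i)
      then show ?case
        using cong_trans[OF step[OF Suc.prems]] by simp
    qed simp
    moreover have "x \<in> {..<?m} \<rightarrow>\<^sub>E {0..<int n}"
      using ran pretzel_size_pos[OF ps] by (auto simp: x_def)
    ultimately have "x \<in> ?T"
      unfolding twist_vectors_def by blast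
    then show ?thesis
      using \<open>?\<Phi> x = f\<close> by blast
  qed
  ultimately show ?thesis
    unfolding bij_betw_def by blast
qed


section \<open>Counting the colourings\<close>

text \<open>
  The differences of a twist vector, reduced modulo \<open>n\<close>.
\<close>

definition difference_vectors :: "nat \<Rightarrow> int list \<Rightarrow> (nat \<Rightarrow> int) set" where
  "difference_vectors n ps = {d \<in> {..<length ps} \<rightarrow>\<^sub>E {0..<int n}.
     [(\<Sum>i<length ps. d i) = 0] (mod int n) \<and>
     (\<exists>c. \<forall>i<length ps. [ps ! i * d i = c] (mod int n))}"

lemma sum_cyclic_differences:
  fixes x :: "nat \<Rightarrow> int"
  shows "(\<Sum>i<m. x (Suc i mod m) - x i) = 0"
proof (cases m)
  case (Suc k)
  have "(\<Sum>i<m. x (Suc i mod m)) = (\<Sum>i<k. x (Suc i)) + x 0"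
    by (simp add: Suc)
  also have "\<dots> = (\<Sum>i<m. x i)"
    unfolding Suc sum.lessThan_Suc_shift by simp
  finally show ?thesis
    by (simp add: sum_subtractf)
qed simp

text \<open>
  A vector \<open>x\<close> is recovered from \<open>x 0\<close> and its cyclic differences by partial summation.  Cyclic
  differences sum to zero, and conversely this lets the partial sums close up after \<open>m\<close> steps.
\<close>

lemma card_twist_vectors:
  assumes n: "n > 0" and ps: "ps \<noteq> []"
  shows "card (twist_vectors n ps) = n * card (difference_vectors n ps)"
proof -
  let ?m = "length ps" and ?T = "twist_vectors n ps" and ?D = "difference_vectors n ps"
  let ?f = "\<lambda>x. (x 0, \<lambda>i\<in>{..<?m}. (x (Suc i mod ?m) - x i) mod int n)"
  let ?g = "\<lambda>(a, d). \<lambda>i\<in>{..<?m}. (a + (\<Sum>j<i. d j)) mod int n"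
  have m: "0 < ?m" "Suc i mod ?m < ?m" for i
    using ps by simp_all
  have gf: "?g (?f x) = x" if x: "x \<in> ?T" for x
  proof (rule PiE_ext[of _ "{..<?m}" "\<lambda>_. {0..<int n}"])
    show xPi: "x \<in> {..<?m} \<rightarrow>\<^sub>E {0..<int n}"
      using x by (simp add: twist_vectors_def)
    fix i assume i: "i \<in> {..<?m}"
    have "[x 0 + (\<Sum>j<i. (\<lambda>i\<in>{..<?m}. (x (Suc i mod ?m) - x i) mod int n) j) =
        x 0 + (\<Sum>j<i. x (Suc j) - x j)] (mod int n)"
      using i by (intro cong_add cong_refl cong_sum) auto
    then show "?g (?f x) i = x i"
      using i PiE_mem[OF xPi i] by (simp add: sum_lessThan_telescope cong_def)
  qed (use n in auto)
  \<comment> \<open>For \<open>Suc i = ?m\<close> the index wraps around to \<open>0\<close>, where the empty sum agrees with the full one modulo \<open>n\<close>.\<close>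
  have diff_g: "[?g (a, d) (Suc i mod ?m) - ?g (a, d) i = d i] (mod int n)"
    if d: "d \<in> ?D" and i: "i < ?m" for a d i
  proof -
    have sum0: "[(\<Sum>i<?m. d i) = 0] (mod int n)"
      using d by (simp add: difference_vectors_def)
    have "[(\<Sum>j<Suc i mod ?m. d j) = (\<Sum>j<Suc i. d j)] (mod int n)"
    proof (cases "Suc i = ?m")
      case True
      then show ?thesis
        using sum0 by (metis cong_sym lessThan_0 mod_self sum.empty)
    next
      case False
      then show ?thesis
        using i by simp
    qed
    then have "[(a + (\<Sum>j<Suc i mod ?m. d j)) - (a + (\<Sum>j<i. d j)) =
        (a + (\<Sum>j<Suc i. d j)) - (a + (\<Sum>j<i. d j))] (mod int n)"
      by (intro cong_diff cong_add cong_refl)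
    then show ?thesis
      using i m by (simp add: cong_def mod_diff_eq)
  qed
  have fg: "?f (?g (a, d)) = (a, d)" if a: "a \<in> {0..<int n}" and d: "d \<in> ?D" for a d
  proof -
    have dPi: "d \<in> {..<?m} \<rightarrow>\<^sub>E {0..<int n}"
      using d by (simp add: difference_vectors_def)
    have diff: "(?g (a, d) (Suc i mod ?m) - ?g (a, d) i) mod int n = d i" if i: "i \<in> {..<?m}" for i
      using diff_g[OF d, of i a] i PiE_mem[OF dPi i] unfolding cong_def by simp
    have "(\<lambda>i\<in>{..<?m}. (?g (a, d) (Suc i mod ?m) - ?g (a, d) i) mod int n) =
        restrict d {..<?m}"
      using diff by (rule restrict_ext)
    also have "\<dots> = d"
      using dPi by (rule PiE_restrict)
    finally have "(\<lambda>i\<in>{..<?m}. (?g (a, d) (Suc i mod ?m) - ?g (a, d) i) mod int n) = d" .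
    moreover have "?g (a, d) 0 = a"
      using a m by simp
    ultimately show ?thesis
      by simp
  qed
  have f: "?f x \<in> {0..<int n} \<times> ?D" if x: "x \<in> ?T" for x
  proof -
    have xPi: "x \<in> {..<?m} \<rightarrow>\<^sub>E {0..<int n}"
      using x by (simp add: twist_vectors_def)
    obtain c where c: "\<And>i. i < ?m \<Longrightarrow> [ps ! i * (x (Suc i mod ?m) - x i) = c] (mod int n)"
      using x by (auto simp: twist_vectors_def)
    have "[ps ! i * snd (?f x) i = c] (mod int n)" if "i < ?m" for i
      using c[OF that] that by (simp add: cong_def mod_mult_right_eq)
    moreover have "[(\<Sum>i<?m. snd (?f x) i) = (\<Sum>i<?m. x (Suc i mod ?m) - x i)] (mod int n)"
      by (intro cong_sum) simp
    ultimately show ?thesis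
      using n PiE_mem[OF xPi, of 0] m by (auto simp: difference_vectors_def sum_cyclic_differences)
  qed
  have g: "?g (a, d) \<in> ?T" if a: "a \<in> {0..<int n}" and d: "d \<in> ?D" for a d
  proof -
    obtain c where c: "\<And>i. i < ?m \<Longrightarrow> [ps ! i * d i = c] (mod int n)"
      using d by (auto simp: difference_vectors_def)
    have "[ps ! i * (?g (a, d) (Suc i mod ?m) - ?g (a, d) i) = c] (mod int n)" if i: "i < ?m" for i
      using cong_scalar_left[OF diff_g[OF d i]] c[OF i] by (rule cong_trans)
    moreover have "?g (a, d) \<in> {..<?m} \<rightarrow>\<^sub>E {0..<int n}"
      using n by auto
    ultimately show ?thesis
      unfolding twist_vectors_def by blast
  qed
  have "bij_betw ?f ?T ({0..<int n} \<times> ?D)"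
  proof (rule bij_betw_byWitness[where f' = ?g])
    show "\<forall>x\<in>?T. ?g (?f x) = x"
      using gf by blast
    show "\<forall>y\<in>{0..<int n} \<times> ?D. ?f (?g y) = y"
    proof
      fix y assume "y \<in> {0..<int n} \<times> ?D"
      then obtain a d where y: "y = (a, d)" and "a \<in> {0..<int n}" "d \<in> ?D"
        by (rule SigmaE)
      then show "?f (?g y) = y"
        unfolding y by (intro fg)
    qed
    show "?f ` ?T \<subseteq> {0..<int n} \<times> ?D"
      by (rule image_subsetI) (rule f)
    show "?g ` ({0..<int n} \<times> ?D) \<subseteq> ?T"
    proof (rule image_subsetI)
      fix y assume "y \<in> {0..<int n} \<times> ?D"
      then obtain a d where y: "y = (a, d)" and "a \<in> {0..<int n}" "d \<in> ?D"
        by (rule SigmaE)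
      then show "?g y \<in> ?T"
        unfolding y by (intro g)
    qed
  qed
  then show ?thesis
    by (simp add: bij_betw_same_card card_cartesian_product)
qed

text \<open>
  The common value of the products \<open>ps ! i * d i\<close> is that at \<open>i0\<close>, hence \<open>0\<close>.  So \<open>d\<close> vanishes
  wherever \<open>ps\<close> is a unit.  The entries at the remaining places other than \<open>i0\<close> are free, and
  the entry at \<open>i0\<close> is minus their sum.
\<close>

lemma card_difference_vectors_zero:
  assumes n: "prime n" and i0: "i0 < length ps" "[ps ! i0 = 0] (mod int n)"
  shows "card (difference_vectors n ps) =
    n ^ (card {i. i < length ps \<and> [ps ! i = 0] (mod int n)} - 1)"
proof -
  let ?m = "length ps" and ?D = "difference_vectors n ps"
  let ?Z = "{i. i < length ps \<and> [ps ! i = 0] (mod int n)}"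
  let ?Z' = "?Z - {i0}"
  let ?f = "\<lambda>d. restrict d ?Z'"
  let ?g = "\<lambda>e. \<lambda>i\<in>{..<?m}. if i \<in> ?Z' then e i
    else if i = i0 then (- (\<Sum>j\<in>?Z'. e j)) mod int n else 0"
  have n0: "int n > 0"
    using n prime_gt_0_nat by simp
  have sum_split: "(\<Sum>i<?m. d i) = d i0 + (\<Sum>j\<in>?Z'. d j)"
    if "\<And>i. i < ?m \<Longrightarrow> i \<notin> ?Z \<Longrightarrow> d i = 0" for d :: "nat \<Rightarrow> int"
  proof -
    have "(\<Sum>i<?m. d i) = (\<Sum>i\<in>?Z. d i)"
      using that by (intro sum.mono_neutral_right) auto
    also have "\<dots> = d i0 + (\<Sum>j\<in>?Z'. d j)"
      using i0 by (intro sum.remove) auto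
    finally show ?thesis .
  qed
  have D: "d \<in> ?D \<longleftrightarrow> d \<in> {..<?m} \<rightarrow>\<^sub>E {0..<int n} \<and>
      (\<forall>i<?m. i \<notin> ?Z \<longrightarrow> d i = 0) \<and> [d i0 + (\<Sum>j\<in>?Z'. d j) = 0] (mod int n)" (is "_ \<longleftrightarrow> ?R d") for d
  proof
    assume d: "d \<in> ?D"
    then obtain c where c: "\<And>i. i < ?m \<Longrightarrow> [ps ! i * d i = c] (mod int n)"
      by (auto simp: difference_vectors_def)
    have c0: "[c = 0] (mod int n)"
      using c[OF i0(1)] i0(2) by (metis cong_scalar_right cong_sym cong_trans mult_zero_left)
    have dPi: "d \<in> {..<?m} \<rightarrow>\<^sub>E {0..<int n}"
      using d by (simp add: difference_vectors_def)
    have zero: "d i = 0" if i: "i < ?m" "i \<notin> ?Z" for i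
    proof -
      have "int n dvd ps ! i * d i"
        using cong_trans[OF c[OF i(1)] c0] by (simp add: cong_0_iff)
      then have "int n dvd d i"
        using i n by (simp add: prime_dvd_mult_iff cong_0_iff)
      then show ?thesis
        using PiE_mem[OF dPi, of i] i zdvd_not_zless by fastforce
    qed
    then show "?R d"
      using d dPi sum_split[of d] by (auto simp: difference_vectors_def)
  next
    assume R: "?R d"
    have "[ps ! i * d i = 0] (mod int n)" if "i < ?m" for i
      using R that by (cases "i \<in> ?Z") (auto simp: cong_0_iff)
    then show "d \<in> ?D"
      using R sum_split[of d] unfolding difference_vectors_def by auto
  qed
  have gZ: "?g e j = e j" if "j \<in> ?Z'" for e j
    using that by simp
  have gi0: "?g e i0 = (- (\<Sum>j\<in>?Z'. e j)) mod int n" for e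
    using i0 by simp
  have "bij_betw ?f ?D (?Z' \<rightarrow>\<^sub>E {0..<int n})"
  proof (rule bij_betw_byWitness[where f' = ?g])
    show "\<forall>d\<in>?D. ?g (?f d) = d"
    proof
      fix d assume "d \<in> ?D"
      then have dPi: "d \<in> {..<?m} \<rightarrow>\<^sub>E {0..<int n}" and zero: "\<And>i. i < ?m \<Longrightarrow> i \<notin> ?Z \<Longrightarrow> d i = 0"
        and sum: "[d i0 + (\<Sum>j\<in>?Z'. d j) = 0] (mod int n)"
        by (auto simp: D)
      have "[d i0 = - (\<Sum>j\<in>?Z'. d j)] (mod int n)"
        using sum by (simp add: cong_iff_dvd_diff)
      then have "(- (\<Sum>j\<in>?Z'. d j)) mod int n = d i0"
        using PiE_mem[OF dPi, of i0] i0 by (simp add: cong_def)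
      then have "?g (?f d) i = d i" if "i \<in> {..<?m}" for i
        using zero[of i] that by auto
      then show "?g (?f d) = d"
        using dPi by (auto simp: fun_eq_iff PiE_def extensional_def)
    qed
    show "\<forall>e\<in>?Z' \<rightarrow>\<^sub>E {0..<int n}. ?f (?g e) = e"
      by (auto simp: fun_eq_iff PiE_def extensional_def)
    show "?f ` ?D \<subseteq> ?Z' \<rightarrow>\<^sub>E {0..<int n}"
    proof (rule image_subsetI)
      fix d assume "d \<in> ?D"
      then show "?f d \<in> ?Z' \<rightarrow>\<^sub>E {0..<int n}"
        unfolding restrict_PiE_iff D by auto
    qed
    show "?g ` (?Z' \<rightarrow>\<^sub>E {0..<int n}) \<subseteq> ?D"
    proof (rule image_subsetI)
      fix e assume e: "e \<in> ?Z' \<rightarrow>\<^sub>E {0..<int n}"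
      have "?g e \<in> {..<?m} \<rightarrow>\<^sub>E {0..<int n}"
        using n0 PiE_mem[OF e] by auto
      moreover have "\<forall>i<?m. i \<notin> ?Z \<longrightarrow> ?g e i = 0"
        using i0 by auto
      moreover have "(\<Sum>j\<in>?Z'. ?g e j) = (\<Sum>j\<in>?Z'. e j)"
        by (intro sum.cong refl gZ)
      then have "[?g e i0 + (\<Sum>j\<in>?Z'. ?g e j) = 0] (mod int n)"
        unfolding gi0 by (simp add: cong_def mod_simps)
      ultimately show "?g e \<in> ?D"
        unfolding D by blast
    qed
  qed
  then have "card ?D = card (?Z' \<rightarrow>\<^sub>E {0..<int n})"
    by (rule bij_betw_same_card)
  also have "\<dots> = n ^ card ?Z'"
    by (subst card_PiE) auto
  also have "card ?Z' = card ?Z - 1"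
    using i0 by (intro card_Diff_singleton) auto
  finally show ?thesis .
qed

text \<open>
  Since \<open>ps ! i * P i\<close> is the product \<open>Q\<close> of all entries, the difference vectors are the
  multiples \<open>c P\<close> of the vector \<open>P\<close> whose entries sum to zero.  This avoids inverses of the
  individual entries: the common value of the products is \<open>c Q\<close>, and only \<open>Q\<close> is inverted.
\<close>

lemma card_difference_vectors_units:
  assumes n: "prime n" and ps: "ps \<noteq> []"
    and units: "\<And>i. i < length ps \<Longrightarrow> \<not> [ps ! i = 0] (mod int n)"
  defines "P \<equiv> \<lambda>i. \<Prod>j\<in>{..<length ps} - {i}. ps ! j"
  shows "card (difference_vectors n ps) =
    (if [(\<Sum>i<length ps. P i) = 0] (mod int n) then n else 1)"
proof -
  let ?m = "length ps" and ?D = "difference_vectors n ps"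
  let ?C = "{c \<in> {0..<int n}. [c * (\<Sum>i<?m. P i) = 0] (mod int n)}"
  let ?h = "\<lambda>c. \<lambda>i\<in>{..<?m}. (c * P i) mod int n"
  define Q where "Q = (\<Prod>i<?m. ps ! i)"
  have n0: "int n > 0" and pn: "prime (int n)"
    using n prime_gt_0_nat by simp_all
  have PQ: "ps ! i * P i = Q" if "i < ?m" for i
    unfolding P_def Q_def using that by (intro prod.remove[symmetric]) auto
  have "\<not> int n dvd Q"
    unfolding Q_def using units pn by (simp add: prime_dvd_prod_iff cong_0_iff)
  then have copQ: "coprime Q (int n)"
    using pn prime_imp_coprime coprime_commute by blast
  have copP: "coprime (P i) (int n)" and copps: "coprime (ps ! i) (int n)" if "i < ?m" for i
    using copQ PQ[OF that] by (metis coprime_mult_left_iff)+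
  have m: "0 < ?m"
    using ps by simp
  have sum_h: "[(\<Sum>i<?m. ?h c i) = c * (\<Sum>i<?m. P i)] (mod int n)" for c
    unfolding sum_distrib_left by (intro cong_sum) simp
  have "inj_on ?h ?C"
  proof (rule inj_onI)
    fix c c' assume c: "c \<in> ?C" "c' \<in> ?C" "?h c = ?h c'"
    have "[c * P 0 = c' * P 0] (mod int n)"
      using fun_cong[OF c(3), of 0] m by (simp add: cong_def)
    then have "[c = c'] (mod int n)"
      using cong_mult_rcancel[OF copP[OF m]] by blast
    then show "c = c'"
      using c(1,2) by (simp add: cong_def)
  qed
  moreover have "?h c \<in> ?D" if c: "c \<in> ?C" for c
  proof -
    have "[ps ! i * ?h c i = c * Q] (mod int n)" if "i < ?m" for i
    proof -
      have "[ps ! i * ?h c i = ps ! i * (c * P i)] (mod int n)"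
        using that by (intro cong_mult) simp_all
      then show ?thesis
        using PQ[OF that] by (simp add: ac_simps)
    qed
    moreover have "[(\<Sum>i<?m. ?h c i) = 0] (mod int n)"
      using cong_trans[OF sum_h] c by blast
    moreover have "?h c \<in> {..<?m} \<rightarrow>\<^sub>E {0..<int n}"
      using n0 by auto
    ultimately show ?thesis
      unfolding difference_vectors_def by blast
  qed
  moreover have "d \<in> ?h ` ?C" if d: "d \<in> ?D" for d
  proof -
    obtain b where b: "\<And>i. i < ?m \<Longrightarrow> [ps ! i * d i = b] (mod int n)"
      using d by (auto simp: difference_vectors_def)
    have dPi: "d \<in> {..<?m} \<rightarrow>\<^sub>E {0..<int n}"
      using d by (simp add: difference_vectors_def)
    obtain r where r: "[Q * r = 1] (mod int n)"
      using cong_solve_coprime_int[OF copQ] by blast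
    define c where "c = (b * r) mod int n"
    have c: "[c * Q = b] (mod int n)"
    proof -
      have "[c * Q = b * r * Q] (mod int n)"
        unfolding c_def by (intro cong_mult) simp_all
      also have "b * r * Q = b * (Q * r)"
        by simp
      also have "[b * (Q * r) = b * 1] (mod int n)"
        using r by (intro cong_mult cong_refl)
      finally show ?thesis
        by simp
    qed
    have hd: "?h c i = d i" if i: "i < ?m" for i
    proof -
      have "[ps ! i * (c * P i) = ps ! i * d i] (mod int n)"
        using c b[OF i] PQ[OF i] by (metis cong_sym cong_trans mult.left_commute)
      then have "[c * P i = d i] (mod int n)"
        using cong_mult_lcancel[OF copps[OF i]] by blast
      then show ?thesis
        using i PiE_mem[OF dPi, of i] by (simp add: cong_def)
    qed
    then have "?h c = d"
      using dPi n0 by (intro PiE_ext[of _ "{..<?m}" "\<lambda>_. {0..<int n}" d]) auto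
    moreover have "c \<in> ?C"
    proof -
      have "[c * (\<Sum>i<?m. P i) = (\<Sum>i<?m. ?h c i)] (mod int n)"
        using sum_h cong_sym by blast
      also have "(\<Sum>i<?m. ?h c i) = (\<Sum>i<?m. d i)"
        using hd by (intro sum.cong) auto
      also have "[(\<Sum>i<?m. d i) = 0] (mod int n)"
        using d by (simp add: difference_vectors_def)
      finally show ?thesis
        using n0 by (simp add: c_def)
    qed
    ultimately show ?thesis
      by blast
  qed
  ultimately have "bij_betw ?h ?C ?D"
    unfolding bij_betw_def by blast
  then have "card ?D = card ?C"
    by (simp add: bij_betw_same_card)
  also have "\<dots> = (if [(\<Sum>i<?m. P i) = 0] (mod int n) then n else 1)"
  proof (cases "[(\<Sum>i<?m. P i) = 0] (mod int n)")
    case True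
    then have "?C = {0..<int n}"
      by (auto simp: cong_0_iff)
    then show ?thesis
      using True by simp
  next
    case False
    have "c = 0" if "c \<in> ?C" for c
    proof -
      have "int n dvd c"
        using that False pn by (simp add: cong_0_iff prime_dvd_mult_iff)
      then show ?thesis
        using that zdvd_imp_le[of "int n" c] by force
    qed
    then have "?C = {0}"
      using n0 by auto
    then show ?thesis
      using False by simp
  qed
  finally show ?thesis .
qed

text \<open>
  The factor \<open>n\<close> in front of the number of difference vectors is the choice of the first colour.
  It makes up for the missing one in the exponent \<open>card Z - 1\<close>.
\<close>

theorem card_Hom_pretzel:
  fixes n :: nat
  assumes n: "prime n" and ps: "ps \<noteq> []" "0 \<notin> set ps"
    and out: "is_orientation (pretzel ps) out"
  defines "Z \<equiv> {i. i < length ps \<and> [ps ! i = 0] (mod int n)}"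
  shows "card (quandle_Hom (fundamental_quandle (pretzel ps) out) (dihedral_quandle n)) =
    (if Z \<noteq> {} then n ^ card Z
     else if [(\<Sum>i<length ps. \<Prod>j\<in>{..<length ps} - {i}. ps ! j) = 0] (mod int n) then n ^ 2
     else n)"
proof -
  have n0: "n > 0"
    using n by (rule prime_gt_0_nat)
  have "card (quandle_Hom (fundamental_quandle (pretzel ps) out) (dihedral_quandle n)) =
      card (fox_colourings n (pretzel ps))"
    using wf_diagram_pretzel[OF ps(2)] out quandle_dihedral[OF n0]
    by (simp add: card_Hom_fundamental_quandle end_colourings_dihedral)
  also have "\<dots> = card (twist_vectors n ps)"
    using bij_betw_same_card[OF bij_betw_twist_vectors_fox_colourings[OF ps(2) n0]] by simp
  also have "\<dots> = n * card (difference_vectors n ps)"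
    using n0 ps(1) by (rule card_twist_vectors)
  also have "\<dots> = (if Z \<noteq> {} then n ^ card Z
     else if [(\<Sum>i<length ps. \<Prod>j\<in>{..<length ps} - {i}. ps ! j) = 0] (mod int n) then n ^ 2
     else n)"
  proof (cases "Z = {}")
    case True
    then show ?thesis
      using card_difference_vectors_units[OF n ps(1)]
      by (auto simp: Z_def power2_eq_square)
  next
    case False
    then obtain i0 where "i0 < length ps" "[ps ! i0 = 0] (mod int n)"
      by (auto simp: Z_def)
    then have "card (difference_vectors n ps) = n ^ (card Z - 1)"
      unfolding Z_def by (rule card_difference_vectors_zero[OF n])
    moreover have "card Z > 0"
      using False by (simp add: Z_def card_gt_0_iff)
    ultimately show ?thesis
      using False by (simp flip: power_Suc)
  qed
  finally show ?thesis .
qed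


section \<open>Alternating four-column pretzel links\<close>

theorem corollary27:
  fixes n :: nat and p :: "nat \<Rightarrow> int" and h :: int and N :: nat
    and out :: "((nat \<times> nat) \<times> corner) set"
  assumes "prime n"
    and "\<forall>i\<in>{1..4}. p i > 0"
    and "is_orientation (pretzel [p 1, - p 2, p 3, - p 4]) out"
    and "h = - p 1 * p 2 * p 3 + p 1 * p 2 * p 4 - p 1 * p 3 * p 4 + p 2 * p 3 * p 4"
    and "N = card (quandle_Hom
      (fundamental_quandle (pretzel [p 1, - p 2, p 3, - p 4]) out) (dihedral_quandle n))"
  shows "([h \<noteq> 0] (mod int n) \<longrightarrow> N = n) \<and>
    ([h = 0] (mod int n) \<and> (\<exists>i\<in>{1..4}. \<exists>j\<in>{1..4}. i \<noteq> j \<and> [p i * p j \<noteq> 0] (mod int n))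
      \<longrightarrow> N = n ^ 2) \<and>
    ((\<exists>!i. i \<in> {1..4} \<and> coprime (p i) (int n)) \<longrightarrow> N = n ^ 3) \<and>
    ((\<forall>i\<in>{1..4}. [p i = 0] (mod int n)) \<longrightarrow> N = n ^ 4)"
proof -
  let ?ps = "[p 1, - p 2, p 3, - p 4]"
  let ?z = "\<lambda>i. int n dvd p i"
  let ?Z = "{i. i < length ?ps \<and> [?ps ! i = 0] (mod int n)}"
  have pn: "prime (int n)"
    using assms(1) by simp
  have I: "{1..4} = {1, 2, 3, 4 :: nat}"
    by auto
  have nz: "0 \<notin> set ?ps"
    using assms(2) unfolding I by auto
  have h: "(\<Sum>i<length ?ps. \<Prod>j\<in>{..<length ?ps} - {i}. ?ps ! j) = h"
  proof -
    have "{..<length ?ps} = {0, 1, 2, 3}"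
      by auto
    then show ?thesis
      by (simp add: assms(4) insert_Diff_if algebra_simps)
  qed
  define k where "k = card ?Z"
  have k: "k = of_bool (?z 1) + of_bool (?z 2) + of_bool (?z 3) + of_bool (?z 4)"
  proof -
    have "(\<Sum>i<length ?ps. of_bool ([?ps ! i = 0] (mod int n)) :: nat) =
        of_nat (card ({..<length ?ps} \<inter> {i. [?ps ! i = 0] (mod int n)}))"
      by (rule sum_of_bool_eq[OF finite_lessThan finite_lessThan])
    also have "{..<length ?ps} \<inter> {i. [?ps ! i = 0] (mod int n)} = ?Z"
      by auto
    finally have "card ?Z = (\<Sum>i<length ?ps. of_bool ([?ps ! i = 0] (mod int n)))"
      by (simp only: of_nat_id)
    then show ?thesis
      unfolding k_def by (simp add: cong_0_iff)
  qed
  have "?Z \<noteq> {} \<longleftrightarrow> k \<noteq> 0"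
    by (simp add: k_def)
  then have N: "N = (if k \<noteq> 0 then n ^ k else if int n dvd h then n ^ 2 else n)"
    using card_Hom_pretzel[OF assms(1) _ nz assms(3)]
    unfolding assms(5) h cong_0_iff[of h] k_def by (simp only: list.distinct not_False_eq_True)
  have h1: "int n dvd h \<longleftrightarrow> ?z 2 \<or> ?z 3 \<or> ?z 4" if "?z 1"
  proof -
    have "h = p 1 * (- p 2 * p 3 + p 2 * p 4 - p 3 * p 4) + p 2 * p 3 * p 4"
      unfolding assms(4) by algebra
    then show ?thesis
      using that pn by (simp add: dvd_add_right_iff prime_dvd_mult_iff)
  qed
  have h2: "int n dvd h \<longleftrightarrow> ?z 1 \<or> ?z 3 \<or> ?z 4" if "?z 2"
  proof -
    have "h = p 2 * (- p 1 * p 3 + p 1 * p 4 + p 3 * p 4) - p 1 * p 3 * p 4"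
      unfolding assms(4) by algebra
    then show ?thesis
      using that pn by (simp add: dvd_diff_right_iff prime_dvd_mult_iff)
  qed
  have h3: "int n dvd h \<longleftrightarrow> ?z 1 \<or> ?z 2 \<or> ?z 4" if "?z 3"
  proof -
    have "h = p 3 * (- p 1 * p 2 - p 1 * p 4 + p 2 * p 4) + p 1 * p 2 * p 4"
      unfolding assms(4) by algebra
    then show ?thesis
      using that pn by (simp add: dvd_add_right_iff prime_dvd_mult_iff)
  qed
  have h4: "int n dvd h \<longleftrightarrow> ?z 1 \<or> ?z 2 \<or> ?z 3" if "?z 4"
  proof -
    have "h = p 4 * (p 1 * p 2 - p 1 * p 3 + p 2 * p 3) - p 1 * p 2 * p 3"
      unfolding assms(4) by algebra
    then show ?thesis
      using that pn by (simp add: dvd_diff_right_iff prime_dvd_mult_iff)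
  qed
  \<comment> \<open>If one \<open>p i\<close> vanishes, only the term of \<open>h\<close> that omits it survives; if two vanish, no term does.\<close>
  have h_dvd: "k = 1 \<Longrightarrow> \<not> int n dvd h" "k \<ge> 2 \<Longrightarrow> int n dvd h"
    unfolding k using h1 h2 h3 h4
    by (cases "?z 1"; cases "?z 2"; cases "?z 3"; cases "?z 4"; simp)+
  have coprime_iff: "coprime (p i) (int n) \<longleftrightarrow> \<not> ?z i" for i
    using pn by (metis coprime_commute prime_imp_coprime coprime_absorb_left not_prime_unit)
  have pair: "(\<exists>i\<in>{1..4}. \<exists>j\<in>{1..4}. i \<noteq> j \<and> [p i * p j \<noteq> 0] (mod int n)) \<longleftrightarrow> k \<le> 2"
    unfolding k I using pn
    by (cases "?z 1"; cases "?z 2"; cases "?z 3"; cases "?z 4")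
      (simp_all add: cong_0_iff prime_dvd_mult_iff)
  have one: "k = 3" if ex1: "\<exists>!i. i \<in> {1..4} \<and> coprime (p i) (int n)"
  proof -
    obtain i where i: "i \<in> {1..4}" "\<not> ?z i"
      and uniq: "\<And>j. j \<in> {1..4} \<Longrightarrow> \<not> ?z j \<Longrightarrow> j = i"
      using ex1 unfolding coprime_iff by (elim ex1E) blast
    have z: "?z j \<longleftrightarrow> j \<noteq> i" if "j \<in> {1..4}" for j
      using that i uniq by blast
    have "?z 1 \<longleftrightarrow> 1 \<noteq> i" "?z 2 \<longleftrightarrow> 2 \<noteq> i" "?z 3 \<longleftrightarrow> 3 \<noteq> i" "?z 4 \<longleftrightarrow> 4 \<noteq> i"
      by (rule z; simp)+
    moreover have "i = 1 \<or> i = 2 \<or> i = 3 \<or> i = 4"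
      using i(1) unfolding I by simp
    ultimately show ?thesis
      unfolding k by (elim disjE) simp_all
  qed
  have all: "k = 4" if "\<forall>i\<in>{1..4}. [p i = 0] (mod int n)"
    using that unfolding k I by (simp add: cong_0_iff)
  show ?thesis
    unfolding pair cong_0_iff[of h]
  proof (intro conjI impI)
    assume "\<not> int n dvd h"
    then have "k < 2"
      using h_dvd(2) by linarith
    then show "N = n"
      using N \<open>\<not> int n dvd h\<close> by (cases "k = 0") (simp_all add: less_2_cases_iff)
  next
    assume "int n dvd h \<and> k \<le> 2"
    moreover from this have "k \<noteq> 1"
      using h_dvd(1) by blast
    ultimately show "N = n ^ 2"
      using N by (cases "k = 0") (simp_all add: le_Suc_eq numeral_2_eq_2)
  next
    assume "\<exists>!i. i \<in> {1..4} \<and> coprime (p i) (int n)"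
    then show "N = n ^ 3"
      using N one by simp
  next
    assume "\<forall>i\<in>{1..4}. [p i = 0] (mod int n)"
    then show "N = n ^ 4"
      using N all by simp
  qed
qed

end
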